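(* Let $k$ be a commutative ring and let $(A,C)_\psi$ be an entwining structure over $k$. If there exists a normalised integral map in $(A,C)_\psi$, then any morphism in $\mathbf{M}_A^C(\psi)$ which has a section (resp. retraction) in $\mathbf{M}_A$ has a section (resp. retraction) in $\mathbf{M}_A^C(\psi)$.
   Context: Conventions: $k$ is a commutative ring; algebras are unital $k$-algebras, coalgebras are counital $k$-coalgebras; $\otimes=\otimes_k$, $C^*=\mathrm{Hom}_k(C,k)$, $\mathrm{ev}_C:C\otimes C^*\to k$, $c\otimes\xi\mapsto\xi(c)$; an identity map is denoted by the name of the module; $V\otimes k$ and $k\otimes V$ are identified with $V$. $\mathbf{M}_A$ is the category of right $A$-modules; $\mu$ is the product of $A$, $1_A$ its unit (also as a map $k\to A$), $\Delta,\epsilon$ the coproduct and counit of $C$. Coactions are written $\rho^M(m)=m_{(0)}\otimes m_{(1)}$. An entwining structure $(A,C)_\psi$ consists of a $k$-algebra $A$, a $k$-coalgebra $C$ and a $k$-linear map $\psi:C\otimes A\to A\otimes C$, written $\psi(c\otimes a)=a_\alpha\otimes c^\alpha$ (summation understood), such that $\psi\circ(C\otimes\mu)=(\mu\otimes C)\circ(A\otimes\psi)\circ(\psi\otimes A)$, $\psi(c\otimes 1_A)=1_A\otimes c$, $(A\otimes\Delta)\circ\psi=(\psi\otimes C)\circ(C\otimes\psi)\circ(\Delta\otimes A)$, $(A\otimes\epsilon)\circ\psi=\epsilon\otimes A$. An $(A,C)_\psi$-module is a right $A$-module, right $C$-comodule $M$ with $\rho^M(m\cdot a)=m_{(0)}\cdot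 a_\alpha\otimes m_{(1)}{}^\alpha$ for all $a\in A$, $m\in M$. Morphisms are right $A$-linear, right $C$-colinear maps; the category is $\mathbf{M}_A^C(\psi)$. A normalised integral map in $(A,C)_\psi$ is a $k$-linear map $\phi:C\to C^*\otimes A$ such that (1) $\mu\circ(A\otimes\mathrm{ev}_C\otimes A)\circ(\psi\otimes\phi)\circ(C\otimes\psi)=(\mathrm{ev}_C\otimes\mu)\circ(C\otimes\phi\otimes A)$ as maps $C\otimes C\otimes A\to A$; (2) $(\mathrm{ev}_C\otimes A\otimes C)\circ(C\otimes\phi\otimes C)\circ(C\otimes\Delta)=\psi\circ(C\otimes\mathrm{ev}_C\otimes A)\circ(\Delta\otimes\phi)$ as maps $C\otimes C\to A\otimes C$; (3) $(\mathrm{ev}_C\otimes A)\circ(C\otimes\phi)\circ\Delta=1_A\circ\epsilon$ as maps $C\to A$. A section of $f:N\to M$ is a morphism $g:M\to N$ with $f\circ g=\mathrm{id}_M$; a retraction of $f$ is a morphism $g:M\to N$ with $g\circ f=\mathrm{id}_N$. *)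

theory Defs
  imports "HOL-Algebra.Module" "HOL-Algebra.AbelCoset"
begin

text \<open>
  Everything is relative to a commutative ring \<open>R\<close> and uses the carrier-based modules of
  HOL-Algebra. A module record also has the ring fields \<open>mult\<close> and \<open>one\<close>; they play no role
  for modules that are not algebras and are left unspecified below.
\<close>

section \<open>Linear maps, quotients, free modules\<close>

definition lin_hom ::
    "('k, 'r) ring_scheme \<Rightarrow> ('k, 'm, 'x) module_scheme \<Rightarrow> ('k, 'n, 'y) module_scheme \<Rightarrow> ('m \<Rightarrow> 'n) set"
  where "lin_hom R M N = {f. f \<in> carrier M \<rightarrow> carrier N
    \<and> (\<forall>x\<in>carrier M. \<forall>y\<in>carrier M. f (x \<oplus>\<^bsub>M\<^esub> y) = f x \<oplus>\<^bsub>N\<^esub> f y)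
    \<and> (\<forall>r\<in>carrier R. \<forall>x\<in>carrier M. f (r \<odot>\<^bsub>M\<^esub> x) = r \<odot>\<^bsub>N\<^esub> f x)}"

definition base_module :: "('k, 'r) ring_scheme \<Rightarrow> ('k, 'k) module"
  where "base_module R = \<lparr>carrier = carrier R, mult = mult R, one = one R,
    zero = zero R, add = add R, smult = mult R\<rparr>"

text \<open>The dual module \<open>Hom(C, R)\<close>; its elements are extensional, so that equality of
  linear forms is equality of their values on the carrier.\<close>

definition dual_module :: "('k, 'r) ring_scheme \<Rightarrow> ('k, 'c, 'x) module_scheme \<Rightarrow> ('k, 'c \<Rightarrow> 'k) module"
  where "dual_module R C =
    \<lparr>carrier = lin_hom R C (base_module R) \<inter> extensional (carrier C),
     mult = undefined, one = undefined,
     zero = (\<lambda>c\<in>carrier C. \<zero>\<^bsub>R\<^esub>),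
     add = (\<lambda>f g. \<lambda>c\<in>carrier C. f c \<oplus>\<^bsub>R\<^esub> g c),
     smult = (\<lambda>r f. \<lambda>c\<in>carrier C. r \<otimes>\<^bsub>R\<^esub> f c)\<rparr>"

definition submodule_span :: "('k, 'r) ring_scheme \<Rightarrow> ('k, 'm, 'x) module_scheme \<Rightarrow> 'm set \<Rightarrow> 'm set"
  where "submodule_span R M S = \<Inter>{H. submodule H R M \<and> S \<subseteq> H}"

definition quot_module :: "('k, 'm, 'x) module_scheme \<Rightarrow> 'm set \<Rightarrow> ('k, 'm set) module"
  where "quot_module M H =
    \<lparr>carrier = a_rcosets\<^bsub>M\<^esub> H,
     mult = undefined, one = undefined,
     zero = H,
     add = set_add M,
     smult = (\<lambda>r X. \<Union>x\<in>X. H +>\<^bsub>M\<^esub> (r \<odot>\<^bsub>M\<^esub> x))\<rparr>"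

definition free_module :: "('k, 'r) ring_scheme \<Rightarrow> 's set \<Rightarrow> ('k, 's \<Rightarrow> 'k) module"
  where "free_module R S =
    \<lparr>carrier = {u. range u \<subseteq> carrier R \<and> finite {s. u s \<noteq> \<zero>\<^bsub>R\<^esub>} \<and> {s. u s \<noteq> \<zero>\<^bsub>R\<^esub>} \<subseteq> S},
     mult = undefined, one = undefined,
     zero = (\<lambda>s. \<zero>\<^bsub>R\<^esub>),
     add = (\<lambda>u v s. u s \<oplus>\<^bsub>R\<^esub> v s),
     smult = (\<lambda>r u s. r \<otimes>\<^bsub>R\<^esub> u s)\<rparr>"

definition free_basis :: "('k, 'r) ring_scheme \<Rightarrow> 's \<Rightarrow> 's \<Rightarrow> 'k"
  where "free_basis R s = (\<lambda>t. if t = s then \<one>\<^bsub>R\<^esub> else \<zero>\<^bsub>R\<^esub>)"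


section \<open>Tensor products\<close>

text \<open>\<open>M \<boxtimes>\<^bsub>R\<^esub> N\<close> is the free module on \<open>carrier M \<times> carrier N\<close> modulo the submodule spanned
  by the bilinearity relations; its elements are cosets.\<close>

type_synonym ('k, 'm, 'n) tensor = "('m \<times> 'n \<Rightarrow> 'k) set"

definition bilinear_relators ::
    "('k, 'r) ring_scheme \<Rightarrow> ('k, 'm, 'x) module_scheme \<Rightarrow> ('k, 'n, 'y) module_scheme \<Rightarrow> ('m \<times> 'n \<Rightarrow> 'k) set"
  where "bilinear_relators R M N =
    (let F = free_module R (carrier M \<times> carrier N); e = free_basis R in
      {(e (m \<oplus>\<^bsub>M\<^esub> m', n) \<ominus>\<^bsub>F\<^esub> e (m, n)) \<ominus>\<^bsub>F\<^esub> e (m', n) | m m' n.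
         m \<in> carrier M \<and> m' \<in> carrier M \<and> n \<in> carrier N}
    \<union> {(e (m, n \<oplus>\<^bsub>N\<^esub> n') \<ominus>\<^bsub>F\<^esub> e (m, n)) \<ominus>\<^bsub>F\<^esub> e (m, n') | m n n'.
         m \<in> carrier M \<and> n \<in> carrier N \<and> n' \<in> carrier N}
    \<union> {e (r \<odot>\<^bsub>M\<^esub> m, n) \<ominus>\<^bsub>F\<^esub> (r \<odot>\<^bsub>F\<^esub> e (m, n)) | r m n.
         r \<in> carrier R \<and> m \<in> carrier M \<and> n \<in> carrier N}
    \<union> {e (m, r \<odot>\<^bsub>N\<^esub> n) \<ominus>\<^bsub>F\<^esub> (r \<odot>\<^bsub>F\<^esub> e (m, n)) | r m n.
         r \<in> carrier R \<and> m \<in> carrier M \<and> n \<in> carrier N})"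

definition tensor_kernel ::
    "('k, 'r) ring_scheme \<Rightarrow> ('k, 'm, 'x) module_scheme \<Rightarrow> ('k, 'n, 'y) module_scheme \<Rightarrow> ('m \<times> 'n \<Rightarrow> 'k) set"
  where "tensor_kernel R M N =
    submodule_span R (free_module R (carrier M \<times> carrier N)) (bilinear_relators R M N)"

definition tensor_module ::
    "('k, 'r) ring_scheme \<Rightarrow> ('k, 'm, 'x) module_scheme \<Rightarrow> ('k, 'n, 'y) module_scheme
      \<Rightarrow> ('k, ('k, 'm, 'n) tensor) module"  (infixr \<open>\<boxtimes>\<index>\<close> 75)
  where "M \<boxtimes>\<^bsub>R\<^esub> N = quot_module (free_module R (carrier M \<times> carrier N)) (tensor_kernel R M N)"

definition pure_tensor ::
    "('k, 'r) ring_scheme \<Rightarrow> ('k, 'm, 'x) module_scheme \<Rightarrow> ('k, 'n, 'y) module_scheme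
      \<Rightarrow> 'm \<Rightarrow> 'n \<Rightarrow> ('k, 'm, 'n) tensor"
  where "pure_tensor R M N m n =
    tensor_kernel R M N +>\<^bsub>free_module R (carrier M \<times> carrier N)\<^esub> free_basis R (m, n)"

text \<open>\<open>tensor_lift R P b\<close> is the linear map into \<open>P\<close> induced by the bilinear map \<open>b\<close>. For bilinear
  \<open>b\<close> the value does not depend on the representative of the coset \<open>X\<close> that is chosen.\<close>

definition tensor_lift ::
    "('k, 'r) ring_scheme \<Rightarrow> ('k, 'p, 'x) module_scheme \<Rightarrow> ('m \<Rightarrow> 'n \<Rightarrow> 'p) \<Rightarrow> ('k, 'm, 'n) tensor \<Rightarrow> 'p"
  where "tensor_lift R P b X =
    (let u = (SOME u. u \<in> X) in
      (\<Oplus>\<^bsub>P\<^esub>p\<in>{p. u p \<noteq> \<zero>\<^bsub>R\<^esub>}. u p \<odot>\<^bsub>P\<^esub> b (fst p) (snd p)))"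

text \<open>The map \<open>f \<otimes> g\<close>; here \<open>M\<close> and \<open>N\<close> are the codomains of \<open>f\<close> and \<open>g\<close>.\<close>

definition tensor_map ::
    "('k, 'r) ring_scheme \<Rightarrow> ('k, 'm, 'x) module_scheme \<Rightarrow> ('k, 'n, 'y) module_scheme
      \<Rightarrow> ('a \<Rightarrow> 'm) \<Rightarrow> ('b \<Rightarrow> 'n) \<Rightarrow> ('k, 'a, 'b) tensor \<Rightarrow> ('k, 'm, 'n) tensor"
  where "tensor_map R M N f g = tensor_lift R (M \<boxtimes>\<^bsub>R\<^esub> N) (\<lambda>a b. pure_tensor R M N (f a) (g b))"

definition tensor_assoc ::
    "('k, 'r) ring_scheme \<Rightarrow> ('k, 'm, 'x) module_scheme \<Rightarrow> ('k, 'n, 'y) module_scheme \<Rightarrow> ('k, 'p, 'z) module_scheme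
      \<Rightarrow> ('k, ('k, 'm, 'n) tensor, 'p) tensor \<Rightarrow> ('k, 'm, ('k, 'n, 'p) tensor) tensor"
  where "tensor_assoc R M N P =
    tensor_lift R (M \<boxtimes>\<^bsub>R\<^esub> N \<boxtimes>\<^bsub>R\<^esub> P) (\<lambda>t p.
      tensor_lift R (M \<boxtimes>\<^bsub>R\<^esub> N \<boxtimes>\<^bsub>R\<^esub> P) (\<lambda>m n.
        pure_tensor R M (N \<boxtimes>\<^bsub>R\<^esub> P) m (pure_tensor R N P n p)) t)"

definition tensor_assoc_inv ::
    "('k, 'r) ring_scheme \<Rightarrow> ('k, 'm, 'x) module_scheme \<Rightarrow> ('k, 'n, 'y) module_scheme \<Rightarrow> ('k, 'p, 'z) module_scheme
      \<Rightarrow> ('k, 'm, ('k, 'n, 'p) tensor) tensor \<Rightarrow> ('k, ('k, 'm, 'n) tensor, 'p) tensor"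
  where "tensor_assoc_inv R M N P =
    tensor_lift R ((M \<boxtimes>\<^bsub>R\<^esub> N) \<boxtimes>\<^bsub>R\<^esub> P) (\<lambda>m t.
      tensor_lift R ((M \<boxtimes>\<^bsub>R\<^esub> N) \<boxtimes>\<^bsub>R\<^esub> P) (\<lambda>n p.
        pure_tensor R (M \<boxtimes>\<^bsub>R\<^esub> N) P (pure_tensor R M N m n) p) t)"

text \<open>The identifications of \<open>k \<otimes> V\<close> and \<open>V \<otimes> k\<close> with \<open>V\<close>.\<close>

definition tensor_lunit :: "('k, 'r) ring_scheme \<Rightarrow> ('k, 'm, 'x) module_scheme \<Rightarrow> ('k, 'k, 'm) tensor \<Rightarrow> 'm"
  where "tensor_lunit R V = tensor_lift R V (\<lambda>r v. r \<odot>\<^bsub>V\<^esub> v)"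

definition tensor_runit :: "('k, 'r) ring_scheme \<Rightarrow> ('k, 'm, 'x) module_scheme \<Rightarrow> ('k, 'm, 'k) tensor \<Rightarrow> 'm"
  where "tensor_runit R V = tensor_lift R V (\<lambda>v r. r \<odot>\<^bsub>V\<^esub> v)"

definition ev_map :: "('k, 'r) ring_scheme \<Rightarrow> ('k, 'c, 'c \<Rightarrow> 'k) tensor \<Rightarrow> 'k"
  where "ev_map R = tensor_lift R (base_module R) (\<lambda>c \<xi>. \<xi> c)"


section \<open>Algebras, coalgebras, modules, comodules\<close>

text \<open>The locale \<open>algebra\<close> of HOL-Algebra is for commutative algebras.\<close>

locale unital_algebra = module R A + A?: ring A for R (structure) and A (structure) +
  assumes smult_mult_left: "\<lbrakk>r \<in> carrier R; a \<in> carrier A; b \<in> carrier A\<rbrakk> \<Longrightarrow>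
      (r \<odot>\<^bsub>A\<^esub> a) \<otimes>\<^bsub>A\<^esub> b = r \<odot>\<^bsub>A\<^esub> (a \<otimes>\<^bsub>A\<^esub> b)"
    and smult_mult_right: "\<lbrakk>r \<in> carrier R; a \<in> carrier A; b \<in> carrier A\<rbrakk> \<Longrightarrow>
      a \<otimes>\<^bsub>A\<^esub> (r \<odot>\<^bsub>A\<^esub> b) = r \<odot>\<^bsub>A\<^esub> (a \<otimes>\<^bsub>A\<^esub> b)"

definition mult_map :: "('k, 'r) ring_scheme \<Rightarrow> ('k, 'a, 'x) module_scheme \<Rightarrow> ('k, 'a, 'a) tensor \<Rightarrow> 'a"
  where "mult_map R A = tensor_lift R A (mult A)"

record ('k, 'c) coalgebra = "('k, 'c) module" +
  comult :: "'c \<Rightarrow> ('k, 'c, 'c) tensor"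
  counit :: "'c \<Rightarrow> 'k"

locale coalgebra = module R C for R (structure) and C (structure) +
  assumes comult_hom: "comult C \<in> lin_hom R C (C \<boxtimes>\<^bsub>R\<^esub> C)"
    and counit_hom: "counit C \<in> lin_hom R C (base_module R)"
    and coassoc: "c \<in> carrier C \<Longrightarrow>
      tensor_assoc R C C C (tensor_map R (C \<boxtimes>\<^bsub>R\<^esub> C) C (comult C) id (comult C c)) =
      tensor_map R C (C \<boxtimes>\<^bsub>R\<^esub> C) id (comult C) (comult C c)"
    and counit_left: "c \<in> carrier C \<Longrightarrow>
      tensor_lunit R C (tensor_map R (base_module R) C (counit C) id (comult C c)) = c"
    and counit_right: "c \<in> carrier C \<Longrightarrow>
      tensor_runit R C (tensor_map R C (base_module R) id (counit C) (comult C c)) = c"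

record ('k, 'a, 'm) right_module = "('k, 'm) module" +
  ract :: "'m \<Rightarrow> 'a \<Rightarrow> 'm"  (infixl \<open>\<bullet>\<index>\<close> 70)

locale right_module = unital_algebra R A + M?: module R M
  for R (structure) and A (structure) and M (structure) +
  assumes ract_closed: "\<lbrakk>m \<in> carrier M; a \<in> carrier A\<rbrakk> \<Longrightarrow> m \<bullet>\<^bsub>M\<^esub> a \<in> carrier M"
    and ract_add_left: "\<lbrakk>m \<in> carrier M; m' \<in> carrier M; a \<in> carrier A\<rbrakk> \<Longrightarrow>
      (m \<oplus>\<^bsub>M\<^esub> m') \<bullet>\<^bsub>M\<^esub> a = m \<bullet>\<^bsub>M\<^esub> a \<oplus>\<^bsub>M\<^esub> m' \<bullet>\<^bsub>M\<^esub> a"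
    and ract_add_right: "\<lbrakk>m \<in> carrier M; a \<in> carrier A; b \<in> carrier A\<rbrakk> \<Longrightarrow>
      m \<bullet>\<^bsub>M\<^esub> (a \<oplus>\<^bsub>A\<^esub> b) = m \<bullet>\<^bsub>M\<^esub> a \<oplus>\<^bsub>M\<^esub> m \<bullet>\<^bsub>M\<^esub> b"
    and ract_smult_left: "\<lbrakk>r \<in> carrier R; m \<in> carrier M; a \<in> carrier A\<rbrakk> \<Longrightarrow>
      (r \<odot>\<^bsub>M\<^esub> m) \<bullet>\<^bsub>M\<^esub> a = r \<odot>\<^bsub>M\<^esub> (m \<bullet>\<^bsub>M\<^esub> a)"
    and ract_smult_right: "\<lbrakk>r \<in> carrier R; m \<in> carrier M; a \<in> carrier A\<rbrakk> \<Longrightarrow>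
      m \<bullet>\<^bsub>M\<^esub> (r \<odot>\<^bsub>A\<^esub> a) = r \<odot>\<^bsub>M\<^esub> (m \<bullet>\<^bsub>M\<^esub> a)"
    and ract_mult: "\<lbrakk>m \<in> carrier M; a \<in> carrier A; b \<in> carrier A\<rbrakk> \<Longrightarrow>
      m \<bullet>\<^bsub>M\<^esub> (a \<otimes>\<^bsub>A\<^esub> b) = (m \<bullet>\<^bsub>M\<^esub> a) \<bullet>\<^bsub>M\<^esub> b"
    and ract_one: "m \<in> carrier M \<Longrightarrow> m \<bullet>\<^bsub>M\<^esub> \<one>\<^bsub>A\<^esub> = m"

text \<open>The action as a map \<open>M \<otimes> A \<rightarrow> M\<close>.\<close>

definition ract_map :: "('k, 'r) ring_scheme \<Rightarrow> ('k, 'a, 'm, 'x) right_module_scheme \<Rightarrow> ('k, 'm, 'a) tensor \<Rightarrow> 'm"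
  where "ract_map R M = tensor_lift R M (ract M)"

text \<open>Morphisms of right \<open>A\<close>-modules. Linearity over \<open>R\<close> could be omitted for unital modules, since
  \<open>r \<odot> m = m \<bullet> (r \<odot> 1)\<close>.\<close>

definition right_module_hom ::
    "('k, 'r) ring_scheme \<Rightarrow> ('k, 'a, 'x) module_scheme \<Rightarrow> ('k, 'a, 'm, 'y) right_module_scheme
      \<Rightarrow> ('k, 'a, 'n, 'z) right_module_scheme \<Rightarrow> ('m \<Rightarrow> 'n) set"
  where "right_module_hom R A M N =
    {f \<in> lin_hom R M N. \<forall>m\<in>carrier M. \<forall>a\<in>carrier A. f (m \<bullet>\<^bsub>M\<^esub> a) = f m \<bullet>\<^bsub>N\<^esub> a}"

record ('k, 'a, 'c, 'm) entwined_module = "('k, 'a, 'm) right_module" +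
  coact :: "'m \<Rightarrow> ('k, 'm, 'c) tensor"

locale right_comodule = coalgebra R C + M?: module R M
  for R (structure) and C (structure) and M (structure) +
  assumes coact_hom: "coact M \<in> lin_hom R M (M \<boxtimes>\<^bsub>R\<^esub> C)"
    and coact_coassoc: "m \<in> carrier M \<Longrightarrow>
      tensor_assoc R M C C (tensor_map R (M \<boxtimes>\<^bsub>R\<^esub> C) C (coact M) id (coact M m)) =
      tensor_map R M (C \<boxtimes>\<^bsub>R\<^esub> C) id (comult C) (coact M m)"
    and coact_counit: "m \<in> carrier M \<Longrightarrow>
      tensor_runit R M (tensor_map R M (base_module R) id (counit C) (coact M m)) = m"


section \<open>Entwining structures and entwined modules\<close>

locale entwining_structure = unital_algebra R A + C?: coalgebra R C
  for R (structure) and A (structure) and C (structure) and \<psi> +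
  assumes \<psi>_hom: "\<psi> \<in> lin_hom R (C \<boxtimes>\<^bsub>R\<^esub> A) (A \<boxtimes>\<^bsub>R\<^esub> C)"
    and \<psi>_mult: "y \<in> carrier (C \<boxtimes>\<^bsub>R\<^esub> A \<boxtimes>\<^bsub>R\<^esub> A) \<Longrightarrow>
      (\<psi> \<circ> tensor_map R C A id (mult_map R A)) y =
      (tensor_map R A C (mult_map R A) id
        \<circ> tensor_assoc_inv R A A C
        \<circ> tensor_map R A (A \<boxtimes>\<^bsub>R\<^esub> C) id \<psi>
        \<circ> tensor_assoc R A C A
        \<circ> tensor_map R (A \<boxtimes>\<^bsub>R\<^esub> C) A \<psi> id
        \<circ> tensor_assoc_inv R C A A) y"
    and \<psi>_one: "c \<in> carrier C \<Longrightarrow> \<psi> (pure_tensor R C A c \<one>\<^bsub>A\<^esub>) = pure_tensor R A C \<one>\<^bsub>A\<^esub> c"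
    and \<psi>_comult: "x \<in> carrier (C \<boxtimes>\<^bsub>R\<^esub> A) \<Longrightarrow>
      (tensor_map R A (C \<boxtimes>\<^bsub>R\<^esub> C) id (comult C) \<circ> \<psi>) x =
      (tensor_assoc R A C C
        \<circ> tensor_map R (A \<boxtimes>\<^bsub>R\<^esub> C) C \<psi> id
        \<circ> tensor_assoc_inv R C A C
        \<circ> tensor_map R C (A \<boxtimes>\<^bsub>R\<^esub> C) id \<psi>
        \<circ> tensor_assoc R C C A
        \<circ> tensor_map R (C \<boxtimes>\<^bsub>R\<^esub> C) A (comult C) id) x"
    and \<psi>_counit: "x \<in> carrier (C \<boxtimes>\<^bsub>R\<^esub> A) \<Longrightarrow>
      (tensor_runit R A \<circ> tensor_map R A (base_module R) id (counit C) \<circ> \<psi>) x =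
      (tensor_lunit R A \<circ> tensor_map R (base_module R) A (counit C) id) x"

text \<open>In \<open>coact_ract\<close> the right-hand side is \<open>m\<^sub>0 \<bullet> a\<^sub>\<alpha> \<otimes> m\<^sub>1\<^sup>\<alpha>\<close>.\<close>

locale entwined_module =
  entwining_structure R A C \<psi> + right_module R A M + right_comodule R C M
  for R (structure) and A (structure) and C (structure) and \<psi> and M (structure) +
  assumes coact_ract: "\<lbrakk>m \<in> carrier M; a \<in> carrier A\<rbrakk> \<Longrightarrow>
      coact M (m \<bullet>\<^bsub>M\<^esub> a) =
      (tensor_map R M C (ract_map R M) id
        \<circ> tensor_assoc_inv R M A C
        \<circ> tensor_map R M (A \<boxtimes>\<^bsub>R\<^esub> C) id \<psi>
        \<circ> tensor_assoc R M C A) (pure_tensor R (M \<boxtimes>\<^bsub>R\<^esub> C) A (coact M m) a)"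

definition entwined_hom ::
    "('k, 'r) ring_scheme \<Rightarrow> ('k, 'a, 'x) module_scheme \<Rightarrow> ('k, 'c, 'y) coalgebra_scheme
      \<Rightarrow> ('k, 'a, 'c, 'm, 'z) entwined_module_scheme \<Rightarrow> ('k, 'a, 'c, 'n, 'w) entwined_module_scheme
      \<Rightarrow> ('m \<Rightarrow> 'n) set"
  where "entwined_hom R A C M N =
    {f \<in> right_module_hom R A M N.
      \<forall>m\<in>carrier M. coact N (f m) = tensor_map R N C f id (coact M m)}"


section \<open>Normalised integral maps\<close>

text \<open>\<open>ev_contract\<close> is \<open>ev \<otimes> A : C \<otimes> C\<^sup>* \<otimes> A \<rightarrow> A\<close>, where the domain is bracketed as
  \<open>C \<otimes> (C\<^sup>* \<otimes> A)\<close>, the codomain of \<open>C \<otimes> \<phi>\<close>.\<close>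

definition ev_contract ::
    "('k, 'r) ring_scheme \<Rightarrow> ('k, 'a, 'x) module_scheme \<Rightarrow> ('k, 'c, 'y) module_scheme
      \<Rightarrow> ('k, 'c, ('k, 'c \<Rightarrow> 'k, 'a) tensor) tensor \<Rightarrow> 'a"
  where "ev_contract R A C =
    tensor_lunit R A
      \<circ> tensor_map R (base_module R) A (ev_map R) id
      \<circ> tensor_assoc_inv R C (dual_module R C) A"

locale normalised_integral_map = entwining_structure R A C \<psi>
  for R (structure) and A (structure) and C (structure) and \<psi> and \<phi> +
  assumes \<phi>_hom: "\<phi> \<in> lin_hom R C (dual_module R C \<boxtimes>\<^bsub>R\<^esub> A)"
    and \<phi>_ract: "x \<in> carrier (C \<boxtimes>\<^bsub>R\<^esub> C \<boxtimes>\<^bsub>R\<^esub> A) \<Longrightarrow>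
      (mult_map R A
        \<circ> tensor_map R A A id (ev_contract R A C)
        \<circ> tensor_assoc R A C (dual_module R C \<boxtimes>\<^bsub>R\<^esub> A)
        \<circ> tensor_map R (A \<boxtimes>\<^bsub>R\<^esub> C) (dual_module R C \<boxtimes>\<^bsub>R\<^esub> A) \<psi> \<phi>
        \<circ> tensor_assoc_inv R C A C
        \<circ> tensor_map R C (A \<boxtimes>\<^bsub>R\<^esub> C) id \<psi>) x =
      (tensor_lunit R A
        \<circ> tensor_map R (base_module R) A (ev_map R) (mult_map R A)
        \<circ> tensor_assoc_inv R C (dual_module R C) (A \<boxtimes>\<^bsub>R\<^esub> A)
        \<circ> tensor_map R C (dual_module R C \<boxtimes>\<^bsub>R\<^esub> A \<boxtimes>\<^bsub>R\<^esub> A) id (tensor_assoc R (dual_module R C) A A)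
        \<circ> tensor_map R C ((dual_module R C \<boxtimes>\<^bsub>R\<^esub> A) \<boxtimes>\<^bsub>R\<^esub> A) id
            (tensor_map R (dual_module R C \<boxtimes>\<^bsub>R\<^esub> A) A \<phi> id)) x"
    and \<phi>_coact: "y \<in> carrier (C \<boxtimes>\<^bsub>R\<^esub> C) \<Longrightarrow>
      (tensor_map R A C (ev_contract R A C) id
        \<circ> tensor_map R (C \<boxtimes>\<^bsub>R\<^esub> dual_module R C \<boxtimes>\<^bsub>R\<^esub> A) C
            (tensor_map R C (dual_module R C \<boxtimes>\<^bsub>R\<^esub> A) id \<phi>) id
        \<circ> tensor_assoc_inv R C C C
        \<circ> tensor_map R C (C \<boxtimes>\<^bsub>R\<^esub> C) id (comult C)) y =
      (\<psi>
        \<circ> tensor_map R C A id (ev_contract R A C)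
        \<circ> tensor_assoc R C C (dual_module R C \<boxtimes>\<^bsub>R\<^esub> A)
        \<circ> tensor_map R (C \<boxtimes>\<^bsub>R\<^esub> C) (dual_module R C \<boxtimes>\<^bsub>R\<^esub> A) (comult C) \<phi>) y"
    and \<phi>_normalised: "c \<in> carrier C \<Longrightarrow>
      (ev_contract R A C
        \<circ> tensor_map R C (dual_module R C \<boxtimes>\<^bsub>R\<^esub> A) id \<phi>
        \<circ> comult C) c = counit C c \<odot>\<^bsub>A\<^esub> \<one>\<^bsub>A\<^esub>"

end

theory Submission
  imports Defs
begin

text \<open>
  Put \<open>\<theta> = (ev \<otimes> A) \<circ> (C \<otimes> \<phi>) : C \<otimes> C \<rightarrow> A\<close> and, for an entwined module \<open>N\<close>,
  \<open>E (n \<otimes> d) = n\<^sub>0 \<bullet> \<theta> (n\<^sub>1 \<otimes> d)\<close>. The three conditions on \<open>\<phi>\<close> make \<open>E : N \<otimes> C \<rightarrow> N\<close> a morphism of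
  entwined modules that is natural in \<open>N\<close> and splits the coaction of \<open>N\<close>. Hence a right \<open>A\<close>-linear map
  \<open>g : M \<rightarrow> N\<close> can be averaged to the entwined morphism \<open>E \<circ> (g \<otimes> C) \<circ> \<rho>\<^sup>M\<close>, and averaging
  sends sections and retractions of entwined morphisms to sections and retractions.

  Sweedler notation is rendered by \<open>tensor_lift\<close>: the expression \<open>b m\<^sub>0 m\<^sub>1\<close> for a bilinear \<open>b\<close> with
  values in \<open>P\<close> is \<open>tensor_lift R P b (coact M m)\<close>.
\<close>

section \<open>Linear maps\<close>

text \<open>The origin of \<open>E\<close> is an adjunction: sending N to N \<otimes> C, with action
  (n \<otimes> c) a = n a_\<alpha> \<otimes> c^\<alpha> and coaction N \<otimes> \<Delta>, is right
  adjoint to forgetting the coaction, and the coaction is the unit. A natural splitting of the unit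
  lets the forgetful functor reflect sections and retractions. The conditions share the work:
  \<open>\<phi>_ract\<close> gives A-linearity of \<open>E\<close>, \<open>\<phi>_coact\<close>
  gives colinearity, and \<open>\<phi>_normalised\<close> with coassociativity and the counit gives
  the splitting; naturality only uses that morphisms are linear and colinear. The entwined module N
  \<otimes> C is never built: its action and coaction occur written out in \<open>act_psi\<close>
  and \<open>coact_act\<close>. The obstacle is that coactions, values of \<psi> and values of
  \<phi> are not pure tensors, and \<open>tensor_lift\<close> expands an unspecified representative.
  Sums over different bracketings therefore cannot be matched term by term. Such steps are
  equalities of linear maps, tested on pure tensors; this is why linearity side conditions accompany
  nearly every line.\<close>

lemma lin_homI:
  assumes "\<And>x. x \<in> carrier M \<Longrightarrow> f x \<in> carrier N"
    and "\<And>x y. \<lbrakk>x \<in> carrier M; y \<in> carrier M\<rbrakk> \<Longrightarrow> f (x \<oplus>\<^bsub>M\<^esub> y) = f x \<oplus>\<^bsub>N\<^esub> f y"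
    and "\<And>r x. \<lbrakk>r \<in> carrier R; x \<in> carrier M\<rbrakk> \<Longrightarrow> f (r \<odot>\<^bsub>M\<^esub> x) = r \<odot>\<^bsub>N\<^esub> f x"
  shows "f \<in> lin_hom R M N"
  using assms by (auto simp: lin_hom_def)

lemma lin_hom_closed:
  "\<lbrakk>f \<in> lin_hom R M N; x \<in> carrier M\<rbrakk> \<Longrightarrow> f x \<in> carrier N"
  by (auto simp: lin_hom_def)

lemma lin_hom_add:
  "\<lbrakk>f \<in> lin_hom R M N; x \<in> carrier M; y \<in> carrier M\<rbrakk> \<Longrightarrow> f (x \<oplus>\<^bsub>M\<^esub> y) = f x \<oplus>\<^bsub>N\<^esub> f y"
  by (auto simp: lin_hom_def)

lemma lin_hom_smult:
  "\<lbrakk>f \<in> lin_hom R M N; r \<in> carrier R; x \<in> carrier M\<rbrakk> \<Longrightarrow> f (r \<odot>\<^bsub>M\<^esub> x) = r \<odot>\<^bsub>N\<^esub> f x"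
  by (auto simp: lin_hom_def)

lemma lin_hom_ident: "(\<lambda>x. x) \<in> lin_hom R M M"
  by (auto simp: lin_hom_def)

lemma lin_hom_id: "id \<in> lin_hom R M M"
  by (auto simp: lin_hom_def)

lemma lin_hom_comp:
  "\<lbrakk>f \<in> lin_hom R N P; g \<in> lin_hom R M N\<rbrakk> \<Longrightarrow> (\<lambda>x. f (g x)) \<in> lin_hom R M P"
  by (auto simp: lin_hom_def Pi_iff)

lemma lin_hom_zero:
  assumes "module R M" "module R N" "f \<in> lin_hom R M N"
  shows "f \<zero>\<^bsub>M\<^esub> = \<zero>\<^bsub>N\<^esub>"
proof -
  interpret M: module R M by fact
  interpret N: module R N by fact
  have "f (\<zero>\<^bsub>R\<^esub> \<odot>\<^bsub>M\<^esub> \<zero>\<^bsub>M\<^esub>) = \<zero>\<^bsub>R\<^esub> \<odot>\<^bsub>N\<^esub> f \<zero>\<^bsub>M\<^esub>"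
    using assms(3) by (intro lin_hom_smult) auto
  then show ?thesis
    using lin_hom_closed[OF assms(3) M.zero_closed] by simp
qed

lemma lin_hom_a_inv:
  assumes "module R M" "module R N" "f \<in> lin_hom R M N" "x \<in> carrier M"
  shows "f (\<ominus>\<^bsub>M\<^esub> x) = \<ominus>\<^bsub>N\<^esub> f x"
proof -
  interpret M: module R M by fact
  interpret N: module R N by fact
  have "f (\<ominus>\<^bsub>M\<^esub> x) \<oplus>\<^bsub>N\<^esub> f x = f (\<ominus>\<^bsub>M\<^esub> x \<oplus>\<^bsub>M\<^esub> x)"
    using lin_hom_add[OF assms(3)] assms(4) by simp
  also have "\<dots> = \<zero>\<^bsub>N\<^esub>"
    using assms lin_hom_zero[OF assms(1-3)] by (simp add: M.M.l_neg)
  finally show ?thesis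
    using lin_hom_closed[OF assms(3)] assms(4) by (simp add: N.M.minus_equality)
qed

lemma lin_hom_diff:
  assumes "module R M" "module R N" "f \<in> lin_hom R M N" "x \<in> carrier M" "y \<in> carrier M"
  shows "f (x \<ominus>\<^bsub>M\<^esub> y) = f x \<ominus>\<^bsub>N\<^esub> f y"
proof -
  interpret M: module R M by fact
  show ?thesis
    unfolding a_minus_def
    using assms lin_hom_add[OF assms(3)] lin_hom_a_inv[OF assms(1-3)] by simp
qed

lemma submodule_lin_eq:
  assumes "module R M" "module R N" "f \<in> lin_hom R M N" "g \<in> lin_hom R M N"
  shows "submodule {x \<in> carrier M. f x = g x} R M"
proof -
  interpret M: module R M by fact
  show ?thesis
    using assms
    by (intro M.submoduleI)
      (auto simp: lin_hom_add lin_hom_smult lin_hom_zero[OF assms(1,2)] lin_hom_a_inv[OF assms(1,2)])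
qed

lemma lin_hom_zero_map:
  assumes "module R N"
  shows "(\<lambda>x. \<zero>\<^bsub>N\<^esub>) \<in> lin_hom R M N"
proof -
  interpret N: module R N by fact
  show ?thesis by (rule lin_homI) auto
qed

section \<open>The base ring and the dual module\<close>

lemma module_base_module:
  assumes "cring R"
  shows "module R (base_module R)"
proof -
  interpret cring R by fact
  have "abelian_group (base_module R)"
  proof (rule abelian_groupI)
    fix x assume "x \<in> carrier (base_module R)"
    then show "\<exists>y\<in>carrier (base_module R). y \<oplus>\<^bsub>base_module R\<^esub> x = \<zero>\<^bsub>base_module R\<^esub>"
      by (intro bexI[of _ "\<ominus>\<^bsub>R\<^esub> x"]) (auto simp: base_module_def l_neg)
  qed (auto simp: base_module_def a_ac)
  then show ?thesis
    by (intro moduleI is_cring) (auto simp: base_module_def l_distr r_distr m_assoc)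
qed

lemma module_dual_module:
  assumes "module R C"
  shows "module R (dual_module R C)"
proof -
  interpret C: module R C by fact
  have cl: "f c \<in> carrier R" if "f \<in> lin_hom R C (base_module R)" "c \<in> carrier C" for f c
    using lin_hom_closed[OF that] by (simp add: base_module_def)
  have add: "(\<lambda>c\<in>carrier C. f c \<oplus>\<^bsub>R\<^esub> g c) \<in> lin_hom R C (base_module R)"
    if "f \<in> lin_hom R C (base_module R)" "g \<in> lin_hom R C (base_module R)" for f g
    using cl[OF that(1)] cl[OF that(2)] lin_hom_add[OF that(1)] lin_hom_add[OF that(2)]
      lin_hom_smult[OF that(1)] lin_hom_smult[OF that(2)]
    by (intro lin_homI) (auto simp: base_module_def C.R.a_ac C.R.r_distr)
  have smult: "(\<lambda>c\<in>carrier C. r \<otimes>\<^bsub>R\<^esub> f c) \<in> lin_hom R C (base_module R)"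
    if "f \<in> lin_hom R C (base_module R)" "r \<in> carrier R" for f r
    using cl[OF that(1)] lin_hom_add[OF that(1)] lin_hom_smult[OF that(1)] that(2)
    by (intro lin_homI) (auto simp: base_module_def C.R.m_ac C.R.r_distr)
  have zero: "(\<lambda>c\<in>carrier C. \<zero>\<^bsub>R\<^esub>) \<in> lin_hom R C (base_module R)"
    by (intro lin_homI) (auto simp: base_module_def)
  have "abelian_group (dual_module R C)"
  proof (rule abelian_groupI)
    fix f assume f: "f \<in> carrier (dual_module R C)"
    then have f': "f \<in> lin_hom R C (base_module R)" by (simp add: dual_module_def)
    \<comment> \<open>The inverse is taken to be (-1) f, so that its membership in the dual is an
      instance of \<open>smult\<close>.\<close>
    show "\<exists>g\<in>carrier (dual_module R C). g \<oplus>\<^bsub>dual_module R C\<^esub> f = \<zero>\<^bsub>dual_module R C\<^esub>"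
      using smult[OF f', of "\<ominus>\<^bsub>R\<^esub> \<one>\<^bsub>R\<^esub>"] cl[OF f']
      by (intro bexI[of _ "\<lambda>c\<in>carrier C. \<ominus>\<^bsub>R\<^esub> \<one>\<^bsub>R\<^esub> \<otimes>\<^bsub>R\<^esub> f c"])
        (auto simp: dual_module_def C.R.l_minus C.R.l_neg cong: restrict_cong)
  qed (auto simp: dual_module_def zero add intro!: extensionalityI[where A="carrier C"]
      simp: cl C.R.a_ac restrict_extensional)
  then show ?thesis
    by (intro moduleI C.R.is_cring)
      (auto simp: dual_module_def add smult restrict_extensional cl C.R.l_distr C.R.r_distr C.R.m_assoc
        intro!: extensionalityI[where A="carrier C"])
qed


section \<open>Free modules and quotient modules\<close>

lemma module_free_module:
  fixes S :: "'s set"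
  assumes "cring R"
  shows "module R (free_module R S)"
proof -
  interpret cring R by fact
  let ?F = "free_module R S"
  have rng: "u s \<in> carrier R" if "range u \<subseteq> carrier R" for u and s :: 's
    using that by auto
  have add: "(\<lambda>s. u s \<oplus>\<^bsub>R\<^esub> v s) \<in> carrier ?F" if "u \<in> carrier ?F" "v \<in> carrier ?F" for u v
  proof -
    have "{s. u s \<oplus>\<^bsub>R\<^esub> v s \<noteq> \<zero>\<^bsub>R\<^esub>} \<subseteq> {s. u s \<noteq> \<zero>\<^bsub>R\<^esub>} \<union> {s. v s \<noteq> \<zero>\<^bsub>R\<^esub>}" by auto
    then show ?thesis
      using that by (auto simp: free_module_def rng intro: finite_subset)
  qed
  have smult: "(\<lambda>s. r \<otimes>\<^bsub>R\<^esub> u s) \<in> carrier ?F" if "u \<in> carrier ?F" "r \<in> carrier R" for u r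
  proof -
    have "{s. r \<otimes>\<^bsub>R\<^esub> u s \<noteq> \<zero>\<^bsub>R\<^esub>} \<subseteq> {s. u s \<noteq> \<zero>\<^bsub>R\<^esub>}" using that by auto
    then show ?thesis
      using that by (auto simp: free_module_def rng intro: finite_subset)
  qed
  have "abelian_group ?F"
  proof (rule abelian_groupI)
    fix u assume u: "u \<in> carrier ?F"
    show "\<exists>v\<in>carrier ?F. v \<oplus>\<^bsub>?F\<^esub> u = \<zero>\<^bsub>?F\<^esub>"
      using smult[OF u, of "\<ominus>\<^bsub>R\<^esub> \<one>\<^bsub>R\<^esub>"] u
      by (intro bexI[of _ "\<lambda>s. \<ominus>\<^bsub>R\<^esub> \<one>\<^bsub>R\<^esub> \<otimes>\<^bsub>R\<^esub> u s"])
        (auto simp: free_module_def l_minus l_neg rng)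
  next
    show "u \<oplus>\<^bsub>?F\<^esub> v \<in> carrier ?F" if "u \<in> carrier ?F" "v \<in> carrier ?F" for u v
      using add[OF that] by (simp add: free_module_def)
  qed (auto simp: free_module_def rng a_ac)
  moreover have "r \<odot>\<^bsub>?F\<^esub> u \<in> carrier ?F" if "r \<in> carrier R" "u \<in> carrier ?F" for r u
    using smult[OF that(2,1)] by (simp add: free_module_def)
  ultimately show ?thesis
    by (intro moduleI is_cring) (auto simp: free_module_def rng l_distr r_distr m_assoc)
qed

lemma free_basis_closed:
  assumes "cring R" "s \<in> S"
  shows "free_basis R s \<in> carrier (free_module R S)"
proof -
  interpret cring R by fact
  have "{t. free_basis R s t \<noteq> \<zero>\<^bsub>R\<^esub>} \<subseteq> {s}" by (auto simp: free_basis_def)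
  with assms(2) show ?thesis
    by (auto simp: free_module_def free_basis_def intro: finite_subset)
qed

text \<open>Induction on the support: deleting one coefficient changes u by a multiple of a basis
  vector. With \<open>submodule_lin_eq\<close> it shows that linear maps agreeing on basis vectors
  agree everywhere.\<close>

lemma free_module_submodule_eq_carrier:
  fixes S :: "'s set"
  assumes "cring R" and H: "submodule H R (free_module R S)"
    and basis: "\<And>s. s \<in> S \<Longrightarrow> free_basis R s \<in> H" and u: "u \<in> carrier (free_module R S)"
  shows "u \<in> H"
proof -
  interpret cring R by fact
  interpret F: module R "free_module R S" by (rule module_free_module) fact
  \<comment> \<open>The support becomes a separate variable T, with u quantified inside, so that
    finite set induction applies and the hypothesis covers the modified vector.\<close>
  have "\<forall>u\<in>carrier (free_module R S). {s. u s \<noteq> \<zero>\<^bsub>R\<^esub>} = T \<longrightarrow> u \<in> H"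
    if "finite T" for T :: "'s set"
    using that
  proof (induction T)
    case empty
    show ?case
    proof clarify
      fix u :: "'s \<Rightarrow> _" assume "{s. u s \<noteq> \<zero>\<^bsub>R\<^esub>} = {}"
      then have "u = \<zero>\<^bsub>free_module R S\<^esub>" by (auto simp: free_module_def)
      then show "u \<in> H"
        using subgroup.one_closed[OF submodule.axioms(1)[OF H]] by simp
    qed
  next
    case (insert s T)
    show ?case
    proof clarify
      fix u assume u: "u \<in> carrier (free_module R S)" and supp: "{s. u s \<noteq> \<zero>\<^bsub>R\<^esub>} = insert s T"
      define v where "v = u(s := \<zero>\<^bsub>R\<^esub>)"
      have us: "u t \<in> carrier R" for t using u by (auto simp: free_module_def)
      have sS: "s \<in> S" using u supp by (auto simp: free_module_def)
      have suppv: "{t. v t \<noteq> \<zero>\<^bsub>R\<^esub>} = T" using supp insert.hyps(2) by (auto simp: v_def)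
      have "v \<in> carrier (free_module R S)"
        using u insert.hyps(1) suppv supp us by (auto simp: free_module_def v_def)
      then have "v \<in> H" using insert.IH suppv by blast
      moreover have "u s \<odot>\<^bsub>free_module R S\<^esub> free_basis R s \<in> H"
        using F.submoduleE(4)[OF H us basis[OF sS]] .
      moreover have "u = v \<oplus>\<^bsub>free_module R S\<^esub> u s \<odot>\<^bsub>free_module R S\<^esub> free_basis R s"
        using us by (auto simp: free_module_def v_def free_basis_def)
      ultimately show "u \<in> H" using F.submoduleE(5)[OF H] by metis
    qed
  qed
  moreover have "finite {s. u s \<noteq> \<zero>\<^bsub>R\<^esub>}" using u by (simp add: free_module_def)
  ultimately show ?thesis using u by blast
qed

text \<open>The linear extension of b from basis vectors to the free module.
  \<open>tensor_lift\<close> is this map at the chosen representative, which separates linearity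
  from independence of the choice.\<close>

definition free_lift ::
    "('k, 'r) ring_scheme \<Rightarrow> ('k, 'p, 'x) module_scheme \<Rightarrow> ('s \<Rightarrow> 'p) \<Rightarrow> ('s \<Rightarrow> 'k) \<Rightarrow> 'p"
  where "free_lift R P b u = (\<Oplus>\<^bsub>P\<^esub>s\<in>{s. u s \<noteq> \<zero>\<^bsub>R\<^esub>}. u s \<odot>\<^bsub>P\<^esub> b s)"

lemma free_lift_cong:
  assumes "module R P" "b \<in> S \<rightarrow> carrier P" "\<And>s. s \<in> S \<Longrightarrow> b s = b' s"
    and "u \<in> carrier (free_module R S)"
  shows "free_lift R P b u = free_lift R P b' u"
proof -
  interpret P: module R P by fact
  have "b' \<in> S \<rightarrow> carrier P" using assms(2,3) by force
  moreover have "u s \<in> carrier R" for s using assms(4) by (auto simp: free_module_def)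
  ultimately show ?thesis
    unfolding free_lift_def using assms
    by (intro P.M.finsum_cong') (auto simp: free_module_def Pi_iff)
qed

text \<open>The supports of u, v and u + v differ, so additivity can only be read off after all sums
  are taken over one common finite set.\<close>

lemma free_lift_superset:
  assumes "module R P" "b \<in> S \<rightarrow> carrier P" "u \<in> carrier (free_module R S)"
    and "finite T" "T \<subseteq> S" "{s. u s \<noteq> \<zero>\<^bsub>R\<^esub>} \<subseteq> T"
  shows "free_lift R P b u = (\<Oplus>\<^bsub>P\<^esub>s\<in>T. u s \<odot>\<^bsub>P\<^esub> b s)"
proof -
  interpret P: module R P by fact
  have "b s \<in> carrier P" if "s \<in> T" for s using assms(2,5) that by auto
  moreover have "u s \<in> carrier R" for s using assms(3) by (auto simp: free_module_def)
  ultimately show ?thesis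
    unfolding free_lift_def using assms(4,6)
    by (intro P.M.add.finprod_mono_neutral_cong_left) auto
qed

lemma free_lift_lin:
  assumes P: "module R P" and b: "b \<in> S \<rightarrow> carrier P"
  shows "free_lift R P b \<in> lin_hom R (free_module R S) P"
proof (rule lin_homI)
  interpret P: module R P by fact
  interpret F: module R "free_module R S" by (rule module_free_module) (rule P.R.is_cring)
  have val: "u s \<in> carrier R" if "u \<in> carrier (free_module R S)" for u s
    using that by (auto simp: free_module_def)
  fix u assume u: "u \<in> carrier (free_module R S)"
  have supp: "finite {s. u s \<noteq> \<zero>\<^bsub>R\<^esub>}" "{s. u s \<noteq> \<zero>\<^bsub>R\<^esub>} \<subseteq> S"
    using u by (auto simp: free_module_def)
  show "free_lift R P b u \<in> carrier P"
    unfolding free_lift_def using supp(2) b val[OF u]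
    by (intro P.M.finsum_closed) auto
  fix v assume v: "v \<in> carrier (free_module R S)"
  have suppv: "finite {s. v s \<noteq> \<zero>\<^bsub>R\<^esub>}" "{s. v s \<noteq> \<zero>\<^bsub>R\<^esub>} \<subseteq> S"
    using v by (auto simp: free_module_def)
  let ?T = "{s. u s \<noteq> \<zero>\<^bsub>R\<^esub>} \<union> {s. v s \<noteq> \<zero>\<^bsub>R\<^esub>}"
  have T: "finite ?T" "?T \<subseteq> S" using supp suppv by auto
  have bT: "b s \<in> carrier P" if "s \<in> ?T" for s using b T(2) that by auto
  have uv: "(u \<oplus>\<^bsub>free_module R S\<^esub> v) s = u s \<oplus>\<^bsub>R\<^esub> v s" for s by (simp add: free_module_def)
  have "free_lift R P b (u \<oplus>\<^bsub>free_module R S\<^esub> v) =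
      (\<Oplus>\<^bsub>P\<^esub>s\<in>?T. (u \<oplus>\<^bsub>free_module R S\<^esub> v) s \<odot>\<^bsub>P\<^esub> b s)"
    using u v T by (intro free_lift_superset[OF P b]) (auto simp: uv)
  also have "\<dots> = (\<Oplus>\<^bsub>P\<^esub>s\<in>?T. u s \<odot>\<^bsub>P\<^esub> b s \<oplus>\<^bsub>P\<^esub> v s \<odot>\<^bsub>P\<^esub> b s)"
    using bT val[OF u] val[OF v] by (intro P.M.finsum_cong') (auto simp: uv P.smult_l_distr)
  also have "\<dots> = (\<Oplus>\<^bsub>P\<^esub>s\<in>?T. u s \<odot>\<^bsub>P\<^esub> b s) \<oplus>\<^bsub>P\<^esub> (\<Oplus>\<^bsub>P\<^esub>s\<in>?T. v s \<odot>\<^bsub>P\<^esub> b s)"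
    using bT val[OF u] val[OF v] by (intro P.M.finsum_addf) auto
  also have "(\<Oplus>\<^bsub>P\<^esub>s\<in>?T. u s \<odot>\<^bsub>P\<^esub> b s) = free_lift R P b u"
    using u T by (intro free_lift_superset[OF P b, symmetric]) auto
  also have "(\<Oplus>\<^bsub>P\<^esub>s\<in>?T. v s \<odot>\<^bsub>P\<^esub> b s) = free_lift R P b v"
    using v T by (intro free_lift_superset[OF P b, symmetric]) auto
  finally show "free_lift R P b (u \<oplus>\<^bsub>free_module R S\<^esub> v) = free_lift R P b u \<oplus>\<^bsub>P\<^esub> free_lift R P b v" .
next
  interpret P: module R P by fact
  interpret F: module R "free_module R S" by (rule module_free_module) (rule P.R.is_cring)
  fix r u assume r: "r \<in> carrier R" and u: "u \<in> carrier (free_module R S)"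
  have val: "u s \<in> carrier R" for s using u by (auto simp: free_module_def)
  let ?T = "{s. u s \<noteq> \<zero>\<^bsub>R\<^esub>}"
  have T: "finite ?T" "?T \<subseteq> S" using u by (auto simp: free_module_def)
  have bT: "b s \<in> carrier P" if "s \<in> ?T" for s using b T(2) that by auto
  have ru: "(r \<odot>\<^bsub>free_module R S\<^esub> u) s = r \<otimes>\<^bsub>R\<^esub> u s" for s by (simp add: free_module_def)
  have "free_lift R P b (r \<odot>\<^bsub>free_module R S\<^esub> u) =
      (\<Oplus>\<^bsub>P\<^esub>s\<in>?T. (r \<odot>\<^bsub>free_module R S\<^esub> u) s \<odot>\<^bsub>P\<^esub> b s)"
    using u r T by (intro free_lift_superset[OF P b]) (auto simp: ru)
  also have "\<dots> = (\<Oplus>\<^bsub>P\<^esub>s\<in>?T. r \<odot>\<^bsub>P\<^esub> (u s \<odot>\<^bsub>P\<^esub> b s))"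
    using bT val r by (intro P.M.finsum_cong') (auto simp: ru P.smult_assoc1)
  also have "\<dots> = r \<odot>\<^bsub>P\<^esub> free_lift R P b u"
    unfolding free_lift_def using bT val r T by (intro P.finsum_smult_ldistr[symmetric]) auto
  finally show "free_lift R P b (r \<odot>\<^bsub>free_module R S\<^esub> u) = r \<odot>\<^bsub>P\<^esub> free_lift R P b u" .
qed

lemma free_lift_basis:
  assumes P: "module R P" and b: "b \<in> S \<rightarrow> carrier P" and s: "s \<in> S"
  shows "free_lift R P b (free_basis R s) = b s"
proof -
  interpret P: module R P by fact
  have bs: "b s \<in> carrier P" using b s by auto
  have "free_lift R P b (free_basis R s) = (\<Oplus>\<^bsub>P\<^esub>t\<in>{s}. free_basis R s t \<odot>\<^bsub>P\<^esub> b t)"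
    using s by (intro free_lift_superset[OF P b free_basis_closed[OF P.R.is_cring s]])
      (auto simp: free_basis_def)
  also have "\<dots> = b s"
    using bs by (simp add: free_basis_def)
  finally show ?thesis .
qed

section \<open>Quotients by a submodule\<close>

lemma (in module) abelian_subgroup_submodule:
  "submodule H R M \<Longrightarrow> abelian_subgroup H M"
  using submodule.axioms(1) M.abelian_group_axioms M.a_comm
  by (intro abelian_subgroupI3) (auto intro: additive_subgroup.intro)

context module
begin

context
  fixes H
  assumes H: "submodule H R M"
begin

interpretation H: abelian_subgroup H M
  by (rule abelian_subgroup_submodule[OF H])

lemma quot_module_add:
  "\<lbrakk>x \<in> carrier M; y \<in> carrier M\<rbrakk>
    \<Longrightarrow> (H +>\<^bsub>M\<^esub> x) \<oplus>\<^bsub>quot_module M H\<^esub> (H +>\<^bsub>M\<^esub> y) = H +>\<^bsub>M\<^esub> (x \<oplus>\<^bsub>M\<^esub> y)"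
  by (simp add: quot_module_def H.a_rcos_sum)

text \<open>The scalar action on cosets is defined as a union over all representatives; since H is
  closed under scalars, every member of that union is the same coset.\<close>

lemma quot_module_smult:
  assumes r: "r \<in> carrier R" and x: "x \<in> carrier M"
  shows "r \<odot>\<^bsub>quot_module M H\<^esub> (H +>\<^bsub>M\<^esub> x) = H +>\<^bsub>M\<^esub> (r \<odot>\<^bsub>M\<^esub> x)"
proof -
  have "H +>\<^bsub>M\<^esub> (r \<odot>\<^bsub>M\<^esub> y) = H +>\<^bsub>M\<^esub> (r \<odot>\<^bsub>M\<^esub> x)" if y: "y \<in> H +>\<^bsub>M\<^esub> x" for y
  proof -
    obtain h where h: "h \<in> H" "y = h \<oplus>\<^bsub>M\<^esub> x" using y by (auto simp: a_r_coset_def')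
    have hM: "h \<in> carrier M" "r \<odot>\<^bsub>M\<^esub> h \<in> H"
      using h submoduleE(1,4)[OF H] r by auto
    have "r \<odot>\<^bsub>M\<^esub> y = r \<odot>\<^bsub>M\<^esub> h \<oplus>\<^bsub>M\<^esub> r \<odot>\<^bsub>M\<^esub> x"
      using h hM r x by (simp add: smult_r_distr)
    then have "r \<odot>\<^bsub>M\<^esub> y \<in> H +>\<^bsub>M\<^esub> (r \<odot>\<^bsub>M\<^esub> x)"
      using hM(2) by (auto simp: a_r_coset_def')
    then show ?thesis
      using r x by (intro H.a_repr_independence'[symmetric]) auto
  qed
  \<comment> \<open>A union of equal sets is that set only over a nonempty index set; x witnesses
    this.\<close>
  moreover have "x \<in> H +>\<^bsub>M\<^esub> x" using x by (rule H.a_rcos_self)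
  ultimately have "(\<Union>y\<in>H +>\<^bsub>M\<^esub> x. H +>\<^bsub>M\<^esub> (r \<odot>\<^bsub>M\<^esub> y)) = H +>\<^bsub>M\<^esub> (r \<odot>\<^bsub>M\<^esub> x)"
    by (intro UN_constant_eq ballI)
  then show ?thesis by (simp add: quot_module_def)
qed

lemma quot_module_carrier: "carrier (quot_module M H) = (\<lambda>x. H +>\<^bsub>M\<^esub> x) ` carrier M"
  by (auto simp: quot_module_def A_RCOSETS_def')

lemma quot_module_zero: "\<zero>\<^bsub>quot_module M H\<^esub> = H +>\<^bsub>M\<^esub> \<zero>\<^bsub>M\<^esub>"
  by (simp add: quot_module_def H.a_subset)

lemma module_quot_module: "module R (quot_module M H)"
proof -
  have "abelian_group (quot_module M H)"
  proof (rule abelian_groupI)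
    fix X assume "X \<in> carrier (quot_module M H)"
    then obtain x where x: "x \<in> carrier M" "X = H +>\<^bsub>M\<^esub> x" by (auto simp: quot_module_carrier)
    show "\<exists>Y\<in>carrier (quot_module M H). Y \<oplus>\<^bsub>quot_module M H\<^esub> X = \<zero>\<^bsub>quot_module M H\<^esub>"
      using x by (intro bexI[of _ "H +>\<^bsub>M\<^esub> (\<ominus>\<^bsub>M\<^esub> x)"])
        (auto simp: quot_module_carrier quot_module_add quot_module_zero M.l_neg)
  qed (auto simp: quot_module_carrier quot_module_add quot_module_zero M.a_ac)
  then show ?thesis
    by (intro moduleI R.is_cring)
      (auto simp: quot_module_carrier quot_module_add quot_module_smult smult_l_distr smult_r_distr
        smult_assoc1)
qed

lemma quot_module_proj_lin: "(\<lambda>x. H +>\<^bsub>M\<^esub> x) \<in> lin_hom R M (quot_module M H)"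
  by (rule lin_homI) (auto simp: quot_module_carrier quot_module_add quot_module_smult)

lemma quot_module_proj_eq_zero: "x \<in> H \<Longrightarrow> H +>\<^bsub>M\<^esub> x = \<zero>\<^bsub>quot_module M H\<^esub>"
  by (simp add: quot_module_def H.a_rcos_const)

text \<open>Two elements of a coset differ by an element of H, which h kills. This is what later
  makes the choice of representative in \<open>tensor_lift\<close> harmless.\<close>

lemma lin_hom_coset_const:
  assumes "module R P" "h \<in> lin_hom R M P" "\<And>x. x \<in> H \<Longrightarrow> h x = \<zero>\<^bsub>P\<^esub>"
    and x: "x \<in> carrier M" and y: "y \<in> H +>\<^bsub>M\<^esub> x"
  shows "h y = h x"
proof -
  interpret P: module R P by fact
  obtain z where z: "z \<in> H" "y = z \<oplus>\<^bsub>M\<^esub> x" using y by (auto simp: a_r_coset_def')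
  have "z \<in> carrier M" using z(1) H.a_subset by auto
  then show ?thesis
    using z x assms(3) lin_hom_add[OF assms(2)] lin_hom_closed[OF assms(2)] by simp
qed

lemma coset_self: "x \<in> carrier M \<Longrightarrow> x \<in> H +>\<^bsub>M\<^esub> x"
  by (rule H.a_rcos_self)

end

end

lemma submodule_span_submodule:
  assumes "module R M" "S \<subseteq> carrier M"
  shows "submodule (submodule_span R M S) R M"
proof -
  interpret M: module R M by fact
  have zero: "\<zero>\<^bsub>M\<^esub> \<in> H" if "submodule H R M" for H
    using subgroup.one_closed[OF submodule.axioms(1)[OF that]] by simp
  \<comment> \<open>The span is an intersection; it lies in the carrier because the carrier is
    itself one of the submodules containing S.\<close>
  have "submodule (carrier M) R M" by (rule M.carrier_is_submodule)
  with assms(2) show ?thesis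
    by (intro M.submoduleI) (auto simp: submodule_span_def zero M.submoduleE(3-5))
qed

lemma submodule_span_superset: "S \<subseteq> submodule_span R M S"
  by (auto simp: submodule_span_def)

lemma submodule_span_least: "\<lbrakk>submodule H R M; S \<subseteq> H\<rbrakk> \<Longrightarrow> submodule_span R M S \<subseteq> H"
  by (auto simp: submodule_span_def)

section \<open>Tensor products\<close>

definition bilin ::
    "('k, 'r) ring_scheme \<Rightarrow> ('k, 'm, 'x) module_scheme \<Rightarrow> ('k, 'n, 'y) module_scheme
      \<Rightarrow> ('k, 'p, 'z) module_scheme \<Rightarrow> ('m \<Rightarrow> 'n \<Rightarrow> 'p) \<Rightarrow> bool"
  where "bilin R M N P b \<longleftrightarrow>
    (\<forall>m\<in>carrier M. (\<lambda>n. b m n) \<in> lin_hom R N P) \<and> (\<forall>n\<in>carrier N. (\<lambda>m. b m n) \<in> lin_hom R M P)"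

lemma bilinI:
  assumes "\<And>m. m \<in> carrier M \<Longrightarrow> (\<lambda>n. b m n) \<in> lin_hom R N P"
    and "\<And>n. n \<in> carrier N \<Longrightarrow> (\<lambda>m. b m n) \<in> lin_hom R M P"
  shows "bilin R M N P b"
  using assms by (simp add: bilin_def)

text \<open>Together with \<open>bilin_lin_left\<close> this peels the outermost bilinear operation
  off a nested expression. Repeated use proves linearity of long composites, and
  \<open>lin_hom_ident\<close> ends the recursion at the variable.\<close>

lemma bilin_lin_right:
  "\<lbrakk>bilin R M N P b; m \<in> carrier M; h \<in> lin_hom R Q N\<rbrakk> \<Longrightarrow> (\<lambda>x. b m (h x)) \<in> lin_hom R Q P"
  unfolding bilin_def by (rule lin_hom_comp[of "b m"]) auto

lemma bilin_lin_left:
  "\<lbrakk>bilin R M N P b; n \<in> carrier N; h \<in> lin_hom R Q M\<rbrakk> \<Longrightarrow> (\<lambda>x. b (h x) n) \<in> lin_hom R Q P"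
  unfolding bilin_def by (rule lin_hom_comp[of "\<lambda>m. b m n"]) auto

lemma bilin_closed:
  "\<lbrakk>bilin R M N P b; m \<in> carrier M; n \<in> carrier N\<rbrakk> \<Longrightarrow> b m n \<in> carrier P"
  by (auto simp: bilin_def dest: lin_hom_closed)

section \<open>The tensor product as a quotient and its universal property\<close>

context
  fixes R :: "('k, 'r) ring_scheme"
    and M :: "('k, 'm, 'x) module_scheme"
    and N :: "('k, 'n, 'y) module_scheme"
  assumes M: "module R M" and N: "module R N"
begin

interpretation M: module R M by (rule M)
interpretation N: module R N by (rule N)

private abbreviation "F \<equiv> free_module R (carrier M \<times> carrier N)"

interpretation F: module R F
  by (rule module_free_module) (rule M.R.is_cring)

private lemma basis_closed [simp]:
  "\<lbrakk>m \<in> carrier M; n \<in> carrier N\<rbrakk> \<Longrightarrow> free_basis R (m, n) \<in> carrier F"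
  by (intro free_basis_closed M.R.is_cring) auto

lemma bilinear_relators_closed: "bilinear_relators R M N \<subseteq> carrier F"
  by (auto simp: bilinear_relators_def Let_def)

lemma tensor_kernel_submodule: "submodule (tensor_kernel R M N) R F"
  unfolding tensor_kernel_def
  by (rule submodule_span_submodule[OF F.module_axioms bilinear_relators_closed])

lemma module_tensor: "module R (M \<boxtimes>\<^bsub>R\<^esub> N)"
  unfolding tensor_module_def by (rule F.module_quot_module[OF tensor_kernel_submodule])

interpretation T: module R "M \<boxtimes>\<^bsub>R\<^esub> N" by (rule module_tensor)

private abbreviation "proj \<equiv> \<lambda>u. tensor_kernel R M N +>\<^bsub>F\<^esub> u"

private lemma proj_lin: "proj \<in> lin_hom R F (M \<boxtimes>\<^bsub>R\<^esub> N)"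
  unfolding tensor_module_def by (rule F.quot_module_proj_lin[OF tensor_kernel_submodule])

private lemma proj_relator: "u \<in> bilinear_relators R M N \<Longrightarrow> proj u = \<zero>\<^bsub>M \<boxtimes>\<^bsub>R\<^esub> N\<^esub>"
  unfolding tensor_module_def
  by (rule F.quot_module_proj_eq_zero[OF tensor_kernel_submodule])
    (use submodule_span_superset[of "bilinear_relators R M N" R F] in \<open>auto simp: tensor_kernel_def\<close>)

private lemmas proj_diff = lin_hom_diff[OF F.module_axioms module_tensor proj_lin]

lemma pure_tensor_closed:
  "\<lbrakk>m \<in> carrier M; n \<in> carrier N\<rbrakk> \<Longrightarrow> pure_tensor R M N m n \<in> carrier (M \<boxtimes>\<^bsub>R\<^esub> N)"
  unfolding pure_tensor_def by (rule lin_hom_closed[OF proj_lin]) simp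

lemma pure_tensor_bilin: "bilin R M N (M \<boxtimes>\<^bsub>R\<^esub> N) (pure_tensor R M N)"
proof -
  \<comment> \<open>Projecting a relator gives a vanishing difference; \<open>eq2\<close> and
    \<open>eq3\<close> turn it back into an equation, \<open>eq2\<close> for the scalar relations
    and \<open>eq3\<close> for the additive ones.\<close>
  have eq2: "a = b" if "a \<ominus>\<^bsub>M \<boxtimes>\<^bsub>R\<^esub> N\<^esub> b = \<zero>\<^bsub>M \<boxtimes>\<^bsub>R\<^esub> N\<^esub>"
    "a \<in> carrier (M \<boxtimes>\<^bsub>R\<^esub> N)" "b \<in> carrier (M \<boxtimes>\<^bsub>R\<^esub> N)" for a b
  proof -
    have "a = (a \<ominus>\<^bsub>M \<boxtimes>\<^bsub>R\<^esub> N\<^esub> b) \<oplus>\<^bsub>M \<boxtimes>\<^bsub>R\<^esub> N\<^esub> b"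
      using that(2,3) by (simp add: a_minus_def T.M.a_assoc T.M.l_neg)
    then show ?thesis using that by simp
  qed
  have eq3: "a = b \<oplus>\<^bsub>M \<boxtimes>\<^bsub>R\<^esub> N\<^esub> c" if "(a \<ominus>\<^bsub>M \<boxtimes>\<^bsub>R\<^esub> N\<^esub> b) \<ominus>\<^bsub>M \<boxtimes>\<^bsub>R\<^esub> N\<^esub> c = \<zero>\<^bsub>M \<boxtimes>\<^bsub>R\<^esub> N\<^esub>"
    "a \<in> carrier (M \<boxtimes>\<^bsub>R\<^esub> N)" "b \<in> carrier (M \<boxtimes>\<^bsub>R\<^esub> N)" "c \<in> carrier (M \<boxtimes>\<^bsub>R\<^esub> N)" for a b c
  proof -
    have "a \<ominus>\<^bsub>M \<boxtimes>\<^bsub>R\<^esub> N\<^esub> b = c" using that by - (rule eq2, auto)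
    then have "b \<oplus>\<^bsub>M \<boxtimes>\<^bsub>R\<^esub> N\<^esub> c = b \<oplus>\<^bsub>M \<boxtimes>\<^bsub>R\<^esub> N\<^esub> (a \<oplus>\<^bsub>M \<boxtimes>\<^bsub>R\<^esub> N\<^esub> \<ominus>\<^bsub>M \<boxtimes>\<^bsub>R\<^esub> N\<^esub> b)"
      by (simp add: a_minus_def)
    also have "\<dots> = a" using that by (simp add: T.M.a_lcomm T.M.r_neg)
    finally show ?thesis by simp
  qed
  show ?thesis
  proof (rule bilinI; rule lin_homI)
    fix m n n' assume m: "m \<in> carrier M" and n: "n \<in> carrier N" and n': "n' \<in> carrier N"
    have "(free_basis R (m, n \<oplus>\<^bsub>N\<^esub> n') \<ominus>\<^bsub>F\<^esub> free_basis R (m, n)) \<ominus>\<^bsub>F\<^esub> free_basis R (m, n')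
        \<in> bilinear_relators R M N"
      using m n n' unfolding bilinear_relators_def Let_def by blast
    from proj_relator[OF this]
    show "pure_tensor R M N m (n \<oplus>\<^bsub>N\<^esub> n') =
        pure_tensor R M N m n \<oplus>\<^bsub>M \<boxtimes>\<^bsub>R\<^esub> N\<^esub> pure_tensor R M N m n'"
      using m n n' pure_tensor_closed by - (rule eq3, auto simp: proj_diff pure_tensor_def)
  next
    fix m m' n assume m: "m \<in> carrier M" and m': "m' \<in> carrier M" and n: "n \<in> carrier N"
    have "(free_basis R (m \<oplus>\<^bsub>M\<^esub> m', n) \<ominus>\<^bsub>F\<^esub> free_basis R (m, n)) \<ominus>\<^bsub>F\<^esub> free_basis R (m', n)
        \<in> bilinear_relators R M N"
      using m m' n unfolding bilinear_relators_def Let_def by blast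
    from proj_relator[OF this]
    show "pure_tensor R M N (m \<oplus>\<^bsub>M\<^esub> m') n =
        pure_tensor R M N m n \<oplus>\<^bsub>M \<boxtimes>\<^bsub>R\<^esub> N\<^esub> pure_tensor R M N m' n"
      using m m' n pure_tensor_closed by - (rule eq3, auto simp: proj_diff pure_tensor_def)
  next
    fix r m n assume r: "r \<in> carrier R" and m: "m \<in> carrier M" and n: "n \<in> carrier N"
    have "free_basis R (m, r \<odot>\<^bsub>N\<^esub> n) \<ominus>\<^bsub>F\<^esub> (r \<odot>\<^bsub>F\<^esub> free_basis R (m, n)) \<in> bilinear_relators R M N"
      using m r n unfolding bilinear_relators_def Let_def by blast
    from proj_relator[OF this]
    show "pure_tensor R M N m (r \<odot>\<^bsub>N\<^esub> n) = r \<odot>\<^bsub>M \<boxtimes>\<^bsub>R\<^esub> N\<^esub> pure_tensor R M N m n"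
      using m n r pure_tensor_closed
      by - (rule eq2, auto simp: proj_diff pure_tensor_def lin_hom_smult[OF proj_lin])
    have "free_basis R (r \<odot>\<^bsub>M\<^esub> m, n) \<ominus>\<^bsub>F\<^esub> (r \<odot>\<^bsub>F\<^esub> free_basis R (m, n)) \<in> bilinear_relators R M N"
      using m r n unfolding bilinear_relators_def Let_def by blast
    from proj_relator[OF this]
    show "pure_tensor R M N (r \<odot>\<^bsub>M\<^esub> m) n = r \<odot>\<^bsub>M \<boxtimes>\<^bsub>R\<^esub> N\<^esub> pure_tensor R M N m n"
      using m n r pure_tensor_closed
      by - (rule eq2, auto simp: proj_diff pure_tensor_def lin_hom_smult[OF proj_lin])
  qed (auto intro: pure_tensor_closed)
qed

private lemma tensor_carrier: "carrier (M \<boxtimes>\<^bsub>R\<^esub> N) = proj ` carrier F"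
  unfolding tensor_module_def by (rule F.quot_module_carrier[OF tensor_kernel_submodule])

private lemma proj_subset: "u \<in> carrier F \<Longrightarrow> proj u \<subseteq> carrier F"
  using F.submoduleE(1)[OF tensor_kernel_submodule] by (auto simp: a_r_coset_def')

text \<open>Cosets are nonempty, so the choice made in \<open>tensor_lift\<close> does pick an
  element of the coset.\<close>

lemma tensor_repr_closed:
  assumes "X \<in> carrier (M \<boxtimes>\<^bsub>R\<^esub> N)"
  shows "(SOME u. u \<in> X) \<in> X" "(SOME u. u \<in> X) \<in> carrier F"
proof -
  obtain u where u: "u \<in> carrier F" "X = proj u" using assms by (auto simp: tensor_carrier)
  then have "u \<in> X" using F.coset_self[OF tensor_kernel_submodule] by simp
  then show *: "(SOME u. u \<in> X) \<in> X" unfolding some_in_eq by blast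
  then show "(SOME u. u \<in> X) \<in> carrier F" using proj_subset[OF u(1)] u(2) by auto
qed

lemma tensor_lift_free_lift:
  "tensor_lift R P b X = free_lift R P (\<lambda>p. b (fst p) (snd p)) (SOME u. u \<in> X)"
  by (simp add: tensor_lift_def free_lift_def Let_def)

text \<open>Pulled back along the projection, the locus where f and g agree is a submodule of the
  free module containing all basis vectors, hence the whole of it.\<close>

lemma lin_hom_tensor_eqI:
  assumes P: "module R P"
    and f: "f \<in> lin_hom R (M \<boxtimes>\<^bsub>R\<^esub> N) P" and g: "g \<in> lin_hom R (M \<boxtimes>\<^bsub>R\<^esub> N) P"
    and eq: "\<And>m n. \<lbrakk>m \<in> carrier M; n \<in> carrier N\<rbrakk> \<Longrightarrow> f (pure_tensor R M N m n) = g (pure_tensor R M N m n)"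
    and X: "X \<in> carrier (M \<boxtimes>\<^bsub>R\<^esub> N)"
  shows "f X = g X"
proof -
  obtain u where u: "u \<in> carrier F" "X = proj u" using X by (auto simp: tensor_carrier)
  have "u \<in> {u \<in> carrier F. f (proj u) = g (proj u)}"
  proof (rule free_module_submodule_eq_carrier[OF M.R.is_cring _ _ u(1)])
    show "submodule {u \<in> carrier F. f (proj u) = g (proj u)} R F"
      by (intro submodule_lin_eq[OF F.module_axioms P] lin_hom_comp[OF f proj_lin]
          lin_hom_comp[OF g proj_lin])
  qed (use eq in \<open>auto simp: pure_tensor_def\<close>)
  then show ?thesis using u by simp
qed

context
  fixes P :: "('k, 'p, 'z) module_scheme"
  assumes P: "module R P"
begin

interpretation P: module R P by (rule P)

lemma tensor_lift_closed:
  assumes "\<And>m n. \<lbrakk>m \<in> carrier M; n \<in> carrier N\<rbrakk> \<Longrightarrow> b m n \<in> carrier P"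
    and X: "X \<in> carrier (M \<boxtimes>\<^bsub>R\<^esub> N)"
  shows "tensor_lift R P b X \<in> carrier P"
  unfolding tensor_lift_free_lift
  using assms by (intro lin_hom_closed[OF free_lift_lin[OF P] tensor_repr_closed(2)[OF X]]) auto

text \<open>Both sides expand the same chosen representative of X, so agreement on the carriers
  gives agreement of the sums term by term.\<close>

lemma tensor_lift_cong:
  assumes "\<And>m n. \<lbrakk>m \<in> carrier M; n \<in> carrier N\<rbrakk> \<Longrightarrow> b m n \<in> carrier P"
    and "\<And>m n. \<lbrakk>m \<in> carrier M; n \<in> carrier N\<rbrakk> \<Longrightarrow> b m n = b' m n"
    and X: "X \<in> carrier (M \<boxtimes>\<^bsub>R\<^esub> N)"
  shows "tensor_lift R P b X = tensor_lift R P b' X"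
  unfolding tensor_lift_free_lift
  using assms by (intro free_lift_cong[OF P _ _ tensor_repr_closed(2)[OF X]]) auto

text \<open>X does not depend on x, so its chosen representative is fixed and the lift is a finite
  combination of maps linear in x. This handles a variable that occurs in the summand of a Sweedler
  sum.\<close>

lemma tensor_lift_lin_body:
  assumes b: "\<And>m n. \<lbrakk>m \<in> carrier M; n \<in> carrier N\<rbrakk> \<Longrightarrow> (\<lambda>x. b x m n) \<in> lin_hom R Q P"
    and X: "X \<in> carrier (M \<boxtimes>\<^bsub>R\<^esub> N)"
  shows "(\<lambda>x. tensor_lift R P (b x) X) \<in> lin_hom R Q P"
proof -
  define u where "u = (SOME u. u \<in> X)"
  have u: "u \<in> carrier F" using tensor_repr_closed(2)[OF X] by (simp add: u_def)
  let ?S = "{p. u p \<noteq> \<zero>\<^bsub>R\<^esub>}"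
  have fin: "finite ?S" and us: "u p \<in> carrier R" for p using u by (auto simp: free_module_def)
  have S: "fst p \<in> carrier M" "snd p \<in> carrier N" if "p \<in> ?S" for p
    using u that by (auto simp: free_module_def)
  have lift: "tensor_lift R P b X = (\<Oplus>\<^bsub>P\<^esub>p\<in>?S. u p \<odot>\<^bsub>P\<^esub> b (fst p) (snd p))" for b
    by (simp add: tensor_lift_def u_def Let_def)
  have cl: "b x (fst p) (snd p) \<in> carrier P" if "p \<in> ?S" "x \<in> carrier Q" for p x
    using lin_hom_closed[OF b[OF S[OF that(1)]] that(2)] .
  show ?thesis
  proof (rule lin_homI)
    fix x assume x: "x \<in> carrier Q"
    show "tensor_lift R P (b x) X \<in> carrier P"
      using lin_hom_closed[OF b x] by (intro tensor_lift_closed X)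
    fix y assume y: "y \<in> carrier Q"
    have "tensor_lift R P (b (x \<oplus>\<^bsub>Q\<^esub> y)) X =
        (\<Oplus>\<^bsub>P\<^esub>p\<in>?S. u p \<odot>\<^bsub>P\<^esub> b x (fst p) (snd p) \<oplus>\<^bsub>P\<^esub> u p \<odot>\<^bsub>P\<^esub> b y (fst p) (snd p))"
      unfolding lift using x y us cl lin_hom_add[OF b[OF S] x y]
      by (intro P.M.finsum_cong') (auto simp: P.smult_r_distr)
    also have "\<dots> = tensor_lift R P (b x) X \<oplus>\<^bsub>P\<^esub> tensor_lift R P (b y) X"
      unfolding lift using x y us cl by (intro P.M.finsum_addf) auto
    finally show "tensor_lift R P (b (x \<oplus>\<^bsub>Q\<^esub> y)) X = \<dots>" .
  next
    fix r x assume r: "r \<in> carrier R" and x: "x \<in> carrier Q"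
    have comm: "u p \<odot>\<^bsub>P\<^esub> (r \<odot>\<^bsub>P\<^esub> z) = r \<odot>\<^bsub>P\<^esub> (u p \<odot>\<^bsub>P\<^esub> z)" if "z \<in> carrier P" for p z
      using that us r by (metis P.smult_assoc1 M.R.m_comm)
    have "tensor_lift R P (b (r \<odot>\<^bsub>Q\<^esub> x)) X = (\<Oplus>\<^bsub>P\<^esub>p\<in>?S. r \<odot>\<^bsub>P\<^esub> (u p \<odot>\<^bsub>P\<^esub> b x (fst p) (snd p)))"
      unfolding lift using x r us cl lin_hom_smult[OF b[OF S] r x]
      by (intro P.M.finsum_cong') (auto simp: comm)
    also have "\<dots> = r \<odot>\<^bsub>P\<^esub> tensor_lift R P (b x) X"
      unfolding lift using x r us cl fin by (intro P.finsum_smult_ldistr[symmetric]) auto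
    finally show "tensor_lift R P (b (r \<odot>\<^bsub>Q\<^esub> x)) X = r \<odot>\<^bsub>P\<^esub> tensor_lift R P (b x) X" .
  qed
qed

context
  fixes b :: "'m \<Rightarrow> 'n \<Rightarrow> 'p"
  assumes b: "bilin R M N P b"
begin

private abbreviation "L \<equiv> free_lift R P (\<lambda>p. b (fst p) (snd p))"

private lemma b_Pi: "(\<lambda>p. b (fst p) (snd p)) \<in> carrier M \<times> carrier N \<rightarrow> carrier P"
  using bilin_closed[OF b] by auto

private lemma L_lin: "L \<in> lin_hom R F P"
  by (rule free_lift_lin[OF P b_Pi])

private lemma L_basis: "\<lbrakk>m \<in> carrier M; n \<in> carrier N\<rbrakk> \<Longrightarrow> L (free_basis R (m, n)) = b m n"
  using free_lift_basis[OF P b_Pi, of "(m, n)"] by simp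

text \<open>The zero set of L, obtained as an equaliser with the zero map, is a submodule; it
  contains the span once it contains the four families of relators, and there each relator is one
  axiom of bilinearity.\<close>

private lemma L_kernel: "u \<in> tensor_kernel R M N \<Longrightarrow> L u = \<zero>\<^bsub>P\<^esub>"
proof -
  have sub: "submodule {u \<in> carrier F. L u = \<zero>\<^bsub>P\<^esub>} R F"
    by (rule submodule_lin_eq[OF F.module_axioms P L_lin lin_hom_zero_map[OF P]])
  have add1: "b (m \<oplus>\<^bsub>M\<^esub> m') n = b m n \<oplus>\<^bsub>P\<^esub> b m' n"
    if "m \<in> carrier M" "m' \<in> carrier M" "n \<in> carrier N" for m m' n
    using b that unfolding bilin_def by (auto dest: lin_hom_add)
  have add2: "b m (n \<oplus>\<^bsub>N\<^esub> n') = b m n \<oplus>\<^bsub>P\<^esub> b m n'"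
    if "m \<in> carrier M" "n \<in> carrier N" "n' \<in> carrier N" for m n n'
    using b that unfolding bilin_def by (auto dest: lin_hom_add)
  have sm: "b (r \<odot>\<^bsub>M\<^esub> m) n = r \<odot>\<^bsub>P\<^esub> b m n" "b m (r \<odot>\<^bsub>N\<^esub> n) = r \<odot>\<^bsub>P\<^esub> b m n"
    if "r \<in> carrier R" "m \<in> carrier M" "n \<in> carrier N" for r m n
    using b that unfolding bilin_def by (auto dest: lin_hom_smult)
  have cancel: "(x \<oplus>\<^bsub>P\<^esub> y) \<ominus>\<^bsub>P\<^esub> x \<ominus>\<^bsub>P\<^esub> y = \<zero>\<^bsub>P\<^esub>" if "x \<in> carrier P" "y \<in> carrier P" for x y
  proof -
    have "(x \<oplus>\<^bsub>P\<^esub> y) \<ominus>\<^bsub>P\<^esub> x = y"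
      using that by (simp add: a_minus_def P.M.a_assoc P.M.a_lcomm[of x y] P.M.r_neg)
    then show ?thesis using that by (simp add: a_minus_def P.M.r_neg)
  qed
  have cancel': "x \<ominus>\<^bsub>P\<^esub> x = \<zero>\<^bsub>P\<^esub>" if "x \<in> carrier P" for x
    using that by (simp add: a_minus_def P.M.r_neg)
  have "L w = \<zero>\<^bsub>P\<^esub>" if "w \<in> bilinear_relators R M N" for w
    using that unfolding bilinear_relators_def Let_def
    by (elim UnE CollectE exE conjE)
      (simp_all add: lin_hom_diff[OF F.module_axioms P L_lin] lin_hom_smult[OF L_lin] L_basis
        add1 add2 sm cancel cancel' bilin_closed[OF b])
  then have "bilinear_relators R M N \<subseteq> {u \<in> carrier F. L u = \<zero>\<^bsub>P\<^esub>}"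
    using bilinear_relators_closed by blast
  from submodule_span_least[OF sub this] show "u \<in> tensor_kernel R M N \<Longrightarrow> L u = \<zero>\<^bsub>P\<^esub>"
    by (auto simp: tensor_kernel_def)
qed

text \<open>Here the dependence on the choice disappears: L is constant on the coset of u, so the
  chosen representative may be replaced by u.\<close>

private lemma tensor_lift_proj: "u \<in> carrier F \<Longrightarrow> tensor_lift R P b (proj u) = L u"
  unfolding tensor_lift_free_lift
  by (rule F.lin_hom_coset_const[OF tensor_kernel_submodule P L_lin L_kernel])
    (auto intro: tensor_repr_closed lin_hom_closed[OF proj_lin])

lemma tensor_lift_lin: "tensor_lift R P b \<in> lin_hom R (M \<boxtimes>\<^bsub>R\<^esub> N) P"
proof (rule lin_homI)
  fix X assume "X \<in> carrier (M \<boxtimes>\<^bsub>R\<^esub> N)"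
  then obtain u where u: "u \<in> carrier F" "X = proj u" by (auto simp: tensor_carrier)
  then show "tensor_lift R P b X \<in> carrier P"
    using lin_hom_closed[OF L_lin] by (simp add: tensor_lift_proj)
  fix Y assume "Y \<in> carrier (M \<boxtimes>\<^bsub>R\<^esub> N)"
  then obtain v where v: "v \<in> carrier F" "Y = proj v" by (auto simp: tensor_carrier)
  show "tensor_lift R P b (X \<oplus>\<^bsub>M \<boxtimes>\<^bsub>R\<^esub> N\<^esub> Y) = tensor_lift R P b X \<oplus>\<^bsub>P\<^esub> tensor_lift R P b Y"
    using u v by (simp add: lin_hom_add[OF proj_lin, symmetric] tensor_lift_proj lin_hom_add[OF L_lin])
next
  fix r X assume r: "r \<in> carrier R" and "X \<in> carrier (M \<boxtimes>\<^bsub>R\<^esub> N)"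
  then obtain u where u: "u \<in> carrier F" "X = proj u" by (auto simp: tensor_carrier)
  then show "tensor_lift R P b (r \<odot>\<^bsub>M \<boxtimes>\<^bsub>R\<^esub> N\<^esub> X) = r \<odot>\<^bsub>P\<^esub> tensor_lift R P b X"
    using r by (simp add: lin_hom_smult[OF proj_lin, symmetric] tensor_lift_proj lin_hom_smult[OF L_lin])
qed

lemma tensor_lift_pure:
  "\<lbrakk>m \<in> carrier M; n \<in> carrier N\<rbrakk> \<Longrightarrow> tensor_lift R P b (pure_tensor R M N m n) = b m n"
  unfolding pure_tensor_def by (simp add: tensor_lift_proj L_basis)

end

lemma lin_hom_pure_bilin:
  assumes h: "h \<in> lin_hom R (M \<boxtimes>\<^bsub>R\<^esub> N) P"
  shows "bilin R M N P (\<lambda>m n. h (pure_tensor R M N m n))"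
  by (intro bilinI lin_hom_comp[OF h] bilin_lin_left[OF pure_tensor_bilin]
      bilin_lin_right[OF pure_tensor_bilin] lin_hom_ident)

lemma lin_hom_tensor_expand:
  assumes h: "h \<in> lin_hom R (M \<boxtimes>\<^bsub>R\<^esub> N) P" and X: "X \<in> carrier (M \<boxtimes>\<^bsub>R\<^esub> N)"
  shows "h X = tensor_lift R P (\<lambda>m n. h (pure_tensor R M N m n)) X"
  by (rule lin_hom_tensor_eqI[OF P h tensor_lift_lin[OF lin_hom_pure_bilin[OF h]] _ X])
    (simp add: tensor_lift_pure[OF lin_hom_pure_bilin[OF h]])

end

end

text \<open>Counterpart of \<open>tensor_lift_lin_body\<close> for a variable that sits in the
  tensor being expanded.\<close>

lemma tensor_lift_lin_arg:
  assumes "bilin R M N P b" "h \<in> lin_hom R Q (M \<boxtimes>\<^bsub>R\<^esub> N)" "module R M" "module R N" "module R P"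
  shows "(\<lambda>x. tensor_lift R P b (h x)) \<in> lin_hom R Q P"
  by (rule lin_hom_comp[OF tensor_lift_lin assms(2)]) (use assms in auto)

text \<open>Converts a composite of structural maps into Sweedler form. What has to be supplied is
  the linearity of the composite and its value on pure tensors.\<close>

lemma lin_hom_eq_tensor_lift:
  assumes "module R M" "module R N" "module R P"
    and h: "h \<in> lin_hom R (M \<boxtimes>\<^bsub>R\<^esub> N) P" and X: "X \<in> carrier (M \<boxtimes>\<^bsub>R\<^esub> N)"
    and eq: "\<And>m n. \<lbrakk>m \<in> carrier M; n \<in> carrier N\<rbrakk> \<Longrightarrow> h (pure_tensor R M N m n) = b m n"
  shows "h X = tensor_lift R P b X"
proof -
  note mods = assms(1-3)
  have "h X = tensor_lift R P (\<lambda>m n. h (pure_tensor R M N m n)) X"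
    by (rule lin_hom_tensor_expand[OF mods h X])
  also have "\<dots> = tensor_lift R P b X"
    by (rule tensor_lift_cong[OF mods lin_hom_closed[OF h pure_tensor_closed[OF mods(1,2)]] eq X])
  finally show ?thesis .
qed

text \<open>The expansion of the identity map. It lets a rule about lifts of coactions speak about
  the coaction itself, with \<open>pure_tensor\<close> as the bilinear map.\<close>

lemma tensor_lift_pure_tensor:
  assumes "module R M" "module R N" "X \<in> carrier (M \<boxtimes>\<^bsub>R\<^esub> N)"
  shows "tensor_lift R (M \<boxtimes>\<^bsub>R\<^esub> N) (pure_tensor R M N) X = X"
  using lin_hom_tensor_expand[OF assms(1,2) module_tensor[OF assms(1,2)] lin_hom_ident assms(3)]
  by simp

lemma tensor_lift_commute:
  assumes mods: "module R M" "module R N" "module R P" "module R Q"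
    and h: "h \<in> lin_hom R P Q" and b: "bilin R M N P b" and X: "X \<in> carrier (M \<boxtimes>\<^bsub>R\<^esub> N)"
  shows "h (tensor_lift R P b X) = tensor_lift R Q (\<lambda>m n. h (b m n)) X"
  by (rule lin_hom_eq_tensor_lift[OF mods(1,2,4) lin_hom_comp[OF h tensor_lift_lin[OF mods(1-3) b]] X])
    (simp add: tensor_lift_pure[OF mods(1-3) b])

text \<open>Fubini for Sweedler sums. The right-hand side is linear in X, since Y is expanded by one
  fixed representative, so its values on pure tensors determine it; there it reduces to the inner
  sum on the left.\<close>

lemma tensor_lift_swap:
  assumes mods: "module R M" "module R N" "module R M'" "module R N'" "module R P"
    and b: "\<And>m' n'. \<lbrakk>m' \<in> carrier M'; n' \<in> carrier N'\<rbrakk> \<Longrightarrow> bilin R M N P (\<lambda>m n. b m n m' n')"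
    and X: "X \<in> carrier (M \<boxtimes>\<^bsub>R\<^esub> N)" and Y: "Y \<in> carrier (M' \<boxtimes>\<^bsub>R\<^esub> N')"
  shows "tensor_lift R P (\<lambda>m n. tensor_lift R P (b m n) Y) X =
    tensor_lift R P (\<lambda>m' n'. tensor_lift R P (\<lambda>m n. b m n m' n') X) Y"
proof (rule lin_hom_eq_tensor_lift[OF mods(1,2,5) _ X, symmetric])
  show "(\<lambda>X. tensor_lift R P (\<lambda>m' n'. tensor_lift R P (\<lambda>m n. b m n m' n') X) Y)
      \<in> lin_hom R (M \<boxtimes>\<^bsub>R\<^esub> N) P"
    by (rule tensor_lift_lin_body[OF mods(3-5) tensor_lift_lin[OF mods(1,2,5) b] Y])
next
  fix m n assume mn: "m \<in> carrier M" "n \<in> carrier N"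
  show "tensor_lift R P (\<lambda>m' n'. tensor_lift R P (\<lambda>m n. b m n m' n') (pure_tensor R M N m n)) Y =
      tensor_lift R P (b m n) Y"
    using mn bilin_closed[OF b mn]
    by (intro tensor_lift_cong[OF mods(3-5) _ _ Y]) (simp_all add: tensor_lift_pure[OF mods(1,2,5) b])
qed

section \<open>Substitution of linear maps and functoriality of the tensor product\<close>

lemma bilin_comp_lin:
  assumes "bilin R M N P b" "f \<in> lin_hom R M' M" "g \<in> lin_hom R N' N"
  shows "bilin R M' N' P (\<lambda>m n. b (f m) (g n))"
  using assms
  by (intro bilinI bilin_lin_left[OF assms(1)] bilin_lin_right[OF assms(1)]) (auto intro: lin_hom_closed)

lemma lin_hom_comp_bilin:
  assumes "h \<in> lin_hom R P Q" "bilin R M N P b"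
  shows "bilin R M N Q (\<lambda>m n. h (b m n))"
  by (intro bilinI lin_hom_comp[OF assms(1)] bilin_lin_left[OF assms(2)] bilin_lin_right[OF assms(2)]
      lin_hom_ident)

text \<open>Trivial up to eta-conversion. It brings a named map into applied form, so that its
  definition unfolds to an expression matched by the linearity rules.\<close>

lemma lin_hom_eta: "(\<lambda>x. f x) \<in> lin_hom R M N \<Longrightarrow> f \<in> lin_hom R M N"
  by simp

context
  fixes R :: "('k, 'r) ring_scheme"
    and M :: "('k, 'm, 'x) module_scheme"
    and N :: "('k, 'n, 'y) module_scheme"
    and M' :: "('k, 'm', 'x1) module_scheme"
    and N' :: "('k, 'n', 'y1) module_scheme"
    and f g
  assumes mods: "module R M" "module R N" "module R M'" "module R N'"
    and f: "f \<in> lin_hom R M M'" and g: "g \<in> lin_hom R N N'"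
begin

private lemma bil: "bilin R M N (M' \<boxtimes>\<^bsub>R\<^esub> N') (\<lambda>m n. pure_tensor R M' N' (f m) (g n))"
  by (rule bilin_comp_lin[OF pure_tensor_bilin[OF mods(3,4)] f g])

lemma tensor_map_lin: "tensor_map R M' N' f g \<in> lin_hom R (M \<boxtimes>\<^bsub>R\<^esub> N) (M' \<boxtimes>\<^bsub>R\<^esub> N')"
  unfolding tensor_map_def by (rule tensor_lift_lin[OF mods(1,2) module_tensor[OF mods(3,4)] bil])

lemma tensor_map_pure:
  "\<lbrakk>m \<in> carrier M; n \<in> carrier N\<rbrakk>
    \<Longrightarrow> tensor_map R M' N' f g (pure_tensor R M N m n) = pure_tensor R M' N' (f m) (g n)"
  unfolding tensor_map_def by (rule tensor_lift_pure[OF mods(1,2) module_tensor[OF mods(3,4)] bil])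

lemma tensor_lift_tensor_map:
  assumes P: "module R P" and b: "bilin R M' N' P b" and X: "X \<in> carrier (M \<boxtimes>\<^bsub>R\<^esub> N)"
  shows "tensor_lift R P b (tensor_map R M' N' f g X) = tensor_lift R P (\<lambda>m n. b (f m) (g n)) X"
  by (rule lin_hom_eq_tensor_lift[OF mods(1,2) P lin_hom_comp[OF tensor_lift_lin[OF mods(3,4) P b] tensor_map_lin] X])
    (simp add: tensor_map_pure tensor_lift_pure[OF mods(3,4) P b] lin_hom_closed[OF f] lin_hom_closed[OF g])

end

section \<open>The associativity maps\<close>

context
  fixes R :: "('k, 'r) ring_scheme"
    and M :: "('k, 'm, 'x) module_scheme"
    and N :: "('k, 'n, 'y) module_scheme"
    and P :: "('k, 'p, 'z) module_scheme"
  assumes mods: "module R M" "module R N" "module R P"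
begin

private lemmas mods' = mods module_tensor[OF mods(1,2)] module_tensor[OF mods(2,3)]
  module_tensor[OF mods(1) module_tensor[OF mods(2,3)]] module_tensor[OF module_tensor[OF mods(1,2)] mods(3)]

private lemmas pures = pure_tensor_bilin[OF mods(1,2)] pure_tensor_bilin[OF mods(2,3)]
  pure_tensor_bilin[OF mods(1) module_tensor[OF mods(2,3)]]
  pure_tensor_bilin[OF module_tensor[OF mods(1,2)] mods(3)]

private lemmas pure_closed = bilin_closed[OF pures(1)] bilin_closed[OF pures(2)]
  bilin_closed[OF pures(3)] bilin_closed[OF pures(4)]

private lemma assoc_inner:
  assumes "p \<in> carrier P"
  shows "bilin R M N (M \<boxtimes>\<^bsub>R\<^esub> N \<boxtimes>\<^bsub>R\<^esub> P)
    (\<lambda>m n. pure_tensor R M (N \<boxtimes>\<^bsub>R\<^esub> P) m (pure_tensor R N P n p))"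
  by (rule bilin_comp_lin[OF pures(3) lin_hom_ident])
    (rule bilin_lin_left[OF pures(2) assms lin_hom_ident])

text \<open>The two arguments need different reasons: t is the tensor expanded by the inner lift,
  while p occurs only in the body of that lift.\<close>

private lemma assoc_outer:
  "bilin R (M \<boxtimes>\<^bsub>R\<^esub> N) P (M \<boxtimes>\<^bsub>R\<^esub> N \<boxtimes>\<^bsub>R\<^esub> P) (\<lambda>t p. tensor_lift R (M \<boxtimes>\<^bsub>R\<^esub> N \<boxtimes>\<^bsub>R\<^esub> P)
    (\<lambda>m n. pure_tensor R M (N \<boxtimes>\<^bsub>R\<^esub> P) m (pure_tensor R N P n p)) t)"
  by (intro bilinI tensor_lift_lin_body[OF mods'(1,2,6)] tensor_lift_lin[OF mods'(1,2,6) assoc_inner]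
      bilin_lin_right[OF pures(3)] bilin_lin_right[OF pures(2)] lin_hom_ident)

lemma tensor_assoc_lin:
  "tensor_assoc R M N P \<in> lin_hom R ((M \<boxtimes>\<^bsub>R\<^esub> N) \<boxtimes>\<^bsub>R\<^esub> P) (M \<boxtimes>\<^bsub>R\<^esub> N \<boxtimes>\<^bsub>R\<^esub> P)"
  unfolding tensor_assoc_def by (rule tensor_lift_lin[OF mods'(4,3,6) assoc_outer])

lemma tensor_assoc_pure:
  "\<lbrakk>m \<in> carrier M; n \<in> carrier N; p \<in> carrier P\<rbrakk>
    \<Longrightarrow> tensor_assoc R M N P (pure_tensor R (M \<boxtimes>\<^bsub>R\<^esub> N) P (pure_tensor R M N m n) p) =
      pure_tensor R M (N \<boxtimes>\<^bsub>R\<^esub> P) m (pure_tensor R N P n p)"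
  unfolding tensor_assoc_def
  by (simp add: tensor_lift_pure[OF mods'(4,3,6) assoc_outer] pure_closed
      tensor_lift_pure[OF mods'(1,2,6) assoc_inner])

private lemma assoc_inv_inner:
  assumes "m \<in> carrier M"
  shows "bilin R N P ((M \<boxtimes>\<^bsub>R\<^esub> N) \<boxtimes>\<^bsub>R\<^esub> P)
    (\<lambda>n p. pure_tensor R (M \<boxtimes>\<^bsub>R\<^esub> N) P (pure_tensor R M N m n) p)"
  by (rule bilin_comp_lin[OF pures(4) _ lin_hom_ident])
    (rule bilin_lin_right[OF pures(1) assms lin_hom_ident])

private lemma assoc_inv_outer:
  "bilin R M (N \<boxtimes>\<^bsub>R\<^esub> P) ((M \<boxtimes>\<^bsub>R\<^esub> N) \<boxtimes>\<^bsub>R\<^esub> P) (\<lambda>m t. tensor_lift R ((M \<boxtimes>\<^bsub>R\<^esub> N) \<boxtimes>\<^bsub>R\<^esub> P)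
    (\<lambda>n p. pure_tensor R (M \<boxtimes>\<^bsub>R\<^esub> N) P (pure_tensor R M N m n) p) t)"
  by (intro bilinI tensor_lift_lin_body[OF mods'(2,3,7)] tensor_lift_lin[OF mods'(2,3,7) assoc_inv_inner]
      bilin_lin_left[OF pures(4)] bilin_lin_left[OF pures(1)] lin_hom_ident)

lemma tensor_assoc_inv_lin:
  "tensor_assoc_inv R M N P \<in> lin_hom R (M \<boxtimes>\<^bsub>R\<^esub> N \<boxtimes>\<^bsub>R\<^esub> P) ((M \<boxtimes>\<^bsub>R\<^esub> N) \<boxtimes>\<^bsub>R\<^esub> P)"
  unfolding tensor_assoc_inv_def by (rule tensor_lift_lin[OF mods'(1,5,7) assoc_inv_outer])

lemma tensor_assoc_inv_pure:
  "\<lbrakk>m \<in> carrier M; n \<in> carrier N; p \<in> carrier P\<rbrakk>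
    \<Longrightarrow> tensor_assoc_inv R M N P (pure_tensor R M (N \<boxtimes>\<^bsub>R\<^esub> P) m (pure_tensor R N P n p)) =
      pure_tensor R (M \<boxtimes>\<^bsub>R\<^esub> N) P (pure_tensor R M N m n) p"
  unfolding tensor_assoc_inv_def
  by (simp add: tensor_lift_pure[OF mods'(1,5,7) assoc_inv_outer] pure_closed
      tensor_lift_pure[OF mods'(2,3,7) assoc_inv_inner])

end

section \<open>Unit identifications, evaluation, multiplication and action\<close>

lemma base_module_simps [simp]:
  "carrier (base_module R) = carrier R"
  "add (base_module R) = add R"
  "smult (base_module R) = mult R"
  by (simp_all add: base_module_def)

context module
begin

lemma base: "module R (base_module R)"
  by (rule module_base_module) (rule R.is_cring)

lemma smult_bilin:
  "bilin R (base_module R) M M (\<lambda>r v. r \<odot>\<^bsub>M\<^esub> v)" "bilin R M (base_module R) M (\<lambda>v r. r \<odot>\<^bsub>M\<^esub> v)"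
proof -
  have "r \<odot>\<^bsub>M\<^esub> (s \<odot>\<^bsub>M\<^esub> x) = s \<odot>\<^bsub>M\<^esub> (r \<odot>\<^bsub>M\<^esub> x)" if "r \<in> carrier R" "s \<in> carrier R" "x \<in> carrier M" for r s x
    using that by (metis smult_assoc1 R.m_comm)
  then show "bilin R (base_module R) M M (\<lambda>r v. r \<odot>\<^bsub>M\<^esub> v)"
    "bilin R M (base_module R) M (\<lambda>v r. r \<odot>\<^bsub>M\<^esub> v)"
    by (auto intro!: bilinI lin_homI simp: smult_l_distr smult_r_distr smult_assoc1)
qed

lemma tensor_lunit_lin: "tensor_lunit R M \<in> lin_hom R (base_module R \<boxtimes>\<^bsub>R\<^esub> M) M"
  unfolding tensor_lunit_def by (rule tensor_lift_lin[OF base module_axioms module_axioms smult_bilin(1)])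

lemma tensor_lunit_pure:
  "\<lbrakk>r \<in> carrier R; x \<in> carrier M\<rbrakk> \<Longrightarrow> tensor_lunit R M (pure_tensor R (base_module R) M r x) = r \<odot>\<^bsub>M\<^esub> x"
  unfolding tensor_lunit_def
  using tensor_lift_pure[OF base module_axioms module_axioms smult_bilin(1)] by simp

lemma tensor_runit_lin: "tensor_runit R M \<in> lin_hom R (M \<boxtimes>\<^bsub>R\<^esub> base_module R) M"
  unfolding tensor_runit_def by (rule tensor_lift_lin[OF module_axioms base module_axioms smult_bilin(2)])

lemma tensor_runit_pure:
  "\<lbrakk>r \<in> carrier R; x \<in> carrier M\<rbrakk> \<Longrightarrow> tensor_runit R M (pure_tensor R M (base_module R) x r) = r \<odot>\<^bsub>M\<^esub> x"
  unfolding tensor_runit_def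
  using tensor_lift_pure[OF module_axioms base module_axioms smult_bilin(2)] by simp

lemma ev_bilin: "bilin R M (dual_module R M) (base_module R) (\<lambda>c \<xi>. \<xi> c)"
  by (intro bilinI)
    (auto simp: dual_module_def base_module_def[symmetric] simp del: base_module_simps
      intro!: lin_homI dest: lin_hom_closed lin_hom_add lin_hom_smult,
     simp_all)

lemma ev_map_lin: "ev_map R \<in> lin_hom R (M \<boxtimes>\<^bsub>R\<^esub> dual_module R M) (base_module R)"
  unfolding ev_map_def
  by (rule tensor_lift_lin[OF module_axioms module_dual_module[OF module_axioms] base ev_bilin])

lemma ev_map_pure:
  "\<lbrakk>c \<in> carrier M; \<xi> \<in> carrier (dual_module R M)\<rbrakk>
    \<Longrightarrow> ev_map R (pure_tensor R M (dual_module R M) c \<xi>) = \<xi> c"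
  unfolding ev_map_def
  by (rule tensor_lift_pure[OF module_axioms module_dual_module[OF module_axioms] base ev_bilin])

lemma dual_module_closed: "\<lbrakk>\<xi> \<in> carrier (dual_module R M); c \<in> carrier M\<rbrakk> \<Longrightarrow> \<xi> c \<in> carrier R"
  by (auto simp: dual_module_def lin_hom_def)

end

context unital_algebra
begin

lemma module_A: "module R A" ..

lemma mult_bilin: "bilin R A A A (mult A)"
  by (intro bilinI lin_homI) (auto simp: A.l_distr A.r_distr smult_mult_left smult_mult_right)

lemma mult_map_lin: "mult_map R A \<in> lin_hom R (A \<boxtimes>\<^bsub>R\<^esub> A) A"
  unfolding mult_map_def by (rule tensor_lift_lin[OF module_A module_A module_A mult_bilin])

lemma mult_map_pure:
  "\<lbrakk>a \<in> carrier A; b \<in> carrier A\<rbrakk> \<Longrightarrow> mult_map R A (pure_tensor R A A a b) = a \<otimes>\<^bsub>A\<^esub> b"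
  unfolding mult_map_def by (rule tensor_lift_pure[OF module_A module_A module_A mult_bilin])

end

context right_module
begin

lemma module_M: "module R M" ..

lemma ract_bilin: "bilin R M A M (ract M)"
  by (intro bilinI lin_homI)
    (auto simp: ract_closed ract_add_left ract_add_right ract_smult_left ract_smult_right)

lemma ract_map_lin: "ract_map R M \<in> lin_hom R (M \<boxtimes>\<^bsub>R\<^esub> A) M"
  unfolding ract_map_def by (rule tensor_lift_lin[OF module_M module_A module_M ract_bilin])

lemma ract_map_pure:
  "\<lbrakk>m \<in> carrier M; a \<in> carrier A\<rbrakk> \<Longrightarrow> ract_map R M (pure_tensor R M A m a) = m \<bullet>\<^bsub>M\<^esub> a"
  unfolding ract_map_def by (rule tensor_lift_pure[OF module_M module_A module_M ract_bilin])

end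

section \<open>The coaction in terms of bilinear maps\<close>

lemma (in coalgebra) module_C: "module R C" ..

lemma (in coalgebra) comult_closed: "c \<in> carrier C \<Longrightarrow> comult C c \<in> carrier (C \<boxtimes>\<^bsub>R\<^esub> C)"
  by (rule lin_hom_closed[OF comult_hom])

lemma (in coalgebra) counit_closed: "c \<in> carrier C \<Longrightarrow> counit C c \<in> carrier R"
  using lin_hom_closed[OF counit_hom] by simp

context right_comodule
begin

lemma module_comodule: "module R M" ..

lemma coact_closed: "m \<in> carrier M \<Longrightarrow> coact M m \<in> carrier (M \<boxtimes>\<^bsub>R\<^esub> C)"
  by (rule lin_hom_closed[OF coact_hom])

lemmas comodule_modules = module_comodule module_C module_tensor[OF module_comodule module_C]
  module_tensor[OF module_C module_C]
  module_tensor[OF module_comodule module_tensor[OF module_C module_C]]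
  module_tensor[OF module_tensor[OF module_comodule module_C] module_C]
  module_base_module[OF R.is_cring]

text \<open>A trilinear b induces a linear map h on M \<otimes> (C \<otimes> C), and applying h to
  the coassociativity axiom gives the two sides. Trilinearity is split into bilinearity in the
  C-variables and linearity in M because h is a nested lift.\<close>

lemma coact_coassoc_lift:
  assumes P: "module R P" and m: "m \<in> carrier M"
    and b: "\<And>n. n \<in> carrier M \<Longrightarrow> bilin R C C P (b n)"
    and b': "\<And>c d. \<lbrakk>c \<in> carrier C; d \<in> carrier C\<rbrakk> \<Longrightarrow> (\<lambda>n. b n c d) \<in> lin_hom R M P"
  shows "tensor_lift R P (\<lambda>n d. tensor_lift R P (\<lambda>n' c. b n' c d) (coact M n)) (coact M m) =
    tensor_lift R P (\<lambda>n d. tensor_lift R P (b n) (comult C d)) (coact M m)"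
proof -
  note mods = comodule_modules
  define h where "h = tensor_lift R P (\<lambda>n t. tensor_lift R P (b n) t)"
  have hb: "bilin R M (C \<boxtimes>\<^bsub>R\<^esub> C) P (\<lambda>n t. tensor_lift R P (b n) t)"
    by (intro bilinI tensor_lift_lin_body[OF mods(2,2) P] tensor_lift_lin[OF mods(2,2) P] b b')
  have h: "h \<in> lin_hom R (M \<boxtimes>\<^bsub>R\<^esub> C \<boxtimes>\<^bsub>R\<^esub> C) P"
    unfolding h_def by (rule tensor_lift_lin[OF mods(1,4) P hb])
  have h_pure: "h (pure_tensor R M (C \<boxtimes>\<^bsub>R\<^esub> C) n t) = tensor_lift R P (b n) t"
    if "n \<in> carrier M" "t \<in> carrier (C \<boxtimes>\<^bsub>R\<^esub> C)" for n t
    unfolding h_def by (rule tensor_lift_pure[OF mods(1,4) P hb that])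
  \<comment> \<open>The left factor is later the coaction of an element and not a pure tensor, so
    reassociation has to be evaluated for an arbitrary tensor X in that place.\<close>
  have inner: "h (tensor_assoc R M C C (pure_tensor R (M \<boxtimes>\<^bsub>R\<^esub> C) C X d)) =
      tensor_lift R P (\<lambda>n c. b n c d) X" if X: "X \<in> carrier (M \<boxtimes>\<^bsub>R\<^esub> C)" and d: "d \<in> carrier C" for X d
  proof (rule lin_hom_eq_tensor_lift[OF mods(1,2) P _ X])
    show "(\<lambda>X. h (tensor_assoc R M C C (pure_tensor R (M \<boxtimes>\<^bsub>R\<^esub> C) C X d))) \<in> lin_hom R (M \<boxtimes>\<^bsub>R\<^esub> C) P"
      by (intro lin_hom_comp[OF h] lin_hom_comp[OF tensor_assoc_lin] mods
          bilin_lin_left[OF pure_tensor_bilin] d lin_hom_ident)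
    show "h (tensor_assoc R M C C (pure_tensor R (M \<boxtimes>\<^bsub>R\<^esub> C) C (pure_tensor R M C n c) d)) = b n c d"
      if "n \<in> carrier M" "c \<in> carrier C" for n c
      using that d by (simp add: id_def tensor_assoc_pure mods h_pure pure_tensor_closed
          tensor_lift_pure[OF mods(2,2) P b])
  qed
  have "h (tensor_assoc R M C C (tensor_map R (M \<boxtimes>\<^bsub>R\<^esub> C) C (coact M) id (coact M m))) =
      tensor_lift R P (\<lambda>n d. tensor_lift R P (\<lambda>n' c. b n' c d) (coact M n)) (coact M m)"
  proof (rule lin_hom_eq_tensor_lift[OF mods(1,2) P _ coact_closed[OF m]])
    show "(\<lambda>X. h (tensor_assoc R M C C (tensor_map R (M \<boxtimes>\<^bsub>R\<^esub> C) C (coact M) id X))) \<in> lin_hom R (M \<boxtimes>\<^bsub>R\<^esub> C) P"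
      by (intro lin_hom_comp[OF h] lin_hom_comp[OF tensor_assoc_lin] mods
          tensor_map_lin coact_hom lin_hom_id)
  qed (simp add: id_def tensor_map_pure[OF mods(1,2,3,2) coact_hom lin_hom_ident] inner coact_closed)
  moreover have "h (tensor_map R M (C \<boxtimes>\<^bsub>R\<^esub> C) id (comult C) (coact M m)) =
      tensor_lift R P (\<lambda>n d. tensor_lift R P (b n) (comult C d)) (coact M m)"
  proof (rule lin_hom_eq_tensor_lift[OF mods(1,2) P _ coact_closed[OF m]])
    show "(\<lambda>X. h (tensor_map R M (C \<boxtimes>\<^bsub>R\<^esub> C) id (comult C) X)) \<in> lin_hom R (M \<boxtimes>\<^bsub>R\<^esub> C) P"
      by (intro lin_hom_comp[OF h] mods tensor_map_lin comult_hom lin_hom_id)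
  qed (simp add: id_def tensor_map_pure[OF mods(1,2,1,4) lin_hom_ident comult_hom] h_pure comult_closed)
  ultimately show ?thesis using coact_coassoc[OF m] by simp
qed

lemma coact_counit_lift:
  assumes m: "m \<in> carrier M"
  shows "tensor_lift R M (\<lambda>n c. counit C c \<odot>\<^bsub>M\<^esub> n) (coact M m) = m"
proof -
  note mods = comodule_modules
  have "tensor_runit R M (tensor_map R M (base_module R) id (counit C) (coact M m)) =
      tensor_lift R M (\<lambda>n c. counit C c \<odot>\<^bsub>M\<^esub> n) (coact M m)"
  proof (rule lin_hom_eq_tensor_lift[OF mods(1,2,1) _ coact_closed[OF m]])
    show "(\<lambda>X. tensor_runit R M (tensor_map R M (base_module R) id (counit C) X)) \<in> lin_hom R (M \<boxtimes>\<^bsub>R\<^esub> C) M"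
      by (intro lin_hom_comp[OF module.tensor_runit_lin] mods tensor_map_lin counit_hom lin_hom_id)
  qed (simp add: id_def tensor_map_pure[OF mods(1,2,1,7) lin_hom_ident counit_hom]
      module.tensor_runit_pure[OF mods(1)] counit_closed)
  then show ?thesis using coact_counit[OF m] by simp
qed

end

context entwining_structure
begin

lemma psi_closed: "\<lbrakk>c \<in> carrier C; a \<in> carrier A\<rbrakk> \<Longrightarrow> \<psi> (pure_tensor R C A c a) \<in> carrier (A \<boxtimes>\<^bsub>R\<^esub> C)"
  by (intro lin_hom_closed[OF \<psi>_hom] pure_tensor_closed module_A module_C)

end

context entwined_module
begin

text \<open>The entwining compatibility tested against a bilinear b: the outer sum runs over the
  coaction of m, the inner one over \<psi>(c \<otimes> a).\<close>

lemma coact_ract_lift: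
  assumes P: "module R P" and b: "bilin R M C P b" and m: "m \<in> carrier M" and a: "a \<in> carrier A"
  shows "tensor_lift R P b (coact M (m \<bullet>\<^bsub>M\<^esub> a)) =
    tensor_lift R P (\<lambda>n c. tensor_lift R P (\<lambda>a' c'. b (n \<bullet>\<^bsub>M\<^esub> a') c') (\<psi> (pure_tensor R C A c a)))
      (coact M m)"
proof -
  note mods = module_M module_A module_C module_tensor[OF module_M module_C]
    module_tensor[OF module_A module_C] module_tensor[OF module_C module_A]
    module_tensor[OF module_M module_A] 
  \<comment> \<open>\<open>?W\<close> is everything that happens after \<psi>. It is isolated
    because its input has a value of \<psi> as right factor, which \<open>inner\<close> must expand
    as a tensor of its own.\<close>
  let ?W = "\<lambda>Z. tensor_map R M C (ract_map R M) id (tensor_assoc_inv R M A C Z)"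
  have W: "?W \<in> lin_hom R (M \<boxtimes>\<^bsub>R\<^esub> A \<boxtimes>\<^bsub>R\<^esub> C) (M \<boxtimes>\<^bsub>R\<^esub> C)"
    by (intro lin_hom_comp[OF tensor_map_lin tensor_assoc_inv_lin] mods ract_map_lin lin_hom_id)
  have inner: "tensor_lift R P b (?W (pure_tensor R M (A \<boxtimes>\<^bsub>R\<^esub> C) n Y)) =
      tensor_lift R P (\<lambda>a' c'. b (n \<bullet>\<^bsub>M\<^esub> a') c') Y"
    if n: "n \<in> carrier M" and Y: "Y \<in> carrier (A \<boxtimes>\<^bsub>R\<^esub> C)" for n Y
  proof (rule lin_hom_eq_tensor_lift[OF mods(2,3) P _ Y])
    show "(\<lambda>Y. tensor_lift R P b (?W (pure_tensor R M (A \<boxtimes>\<^bsub>R\<^esub> C) n Y))) \<in> lin_hom R (A \<boxtimes>\<^bsub>R\<^esub> C) P"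
      by (intro lin_hom_comp[OF tensor_lift_lin[OF mods(1,3) P b]] lin_hom_comp[OF W]
          bilin_lin_right[OF pure_tensor_bilin] n mods lin_hom_ident)
    show "tensor_lift R P b (?W (pure_tensor R M (A \<boxtimes>\<^bsub>R\<^esub> C) n (pure_tensor R A C a' c'))) =
        b (n \<bullet>\<^bsub>M\<^esub> a') c'" if "a' \<in> carrier A" "c' \<in> carrier C" for a' c'
      using that n by (simp add: id_def tensor_assoc_inv_pure mods pure_tensor_closed ract_map_pure ract_closed
          tensor_map_pure[OF mods(7,3,1,3) ract_map_lin lin_hom_ident] tensor_lift_pure[OF mods(1,3) P b])
  qed
  have "tensor_lift R P b (?W (tensor_map R M (A \<boxtimes>\<^bsub>R\<^esub> C) id \<psi>
        (tensor_assoc R M C A (pure_tensor R (M \<boxtimes>\<^bsub>R\<^esub> C) A (coact M m) a)))) =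
      tensor_lift R P (\<lambda>n c. tensor_lift R P (\<lambda>a' c'. b (n \<bullet>\<^bsub>M\<^esub> a') c') (\<psi> (pure_tensor R C A c a)))
        (coact M m)"
  proof (rule lin_hom_eq_tensor_lift[OF mods(1,3) P _ coact_closed[OF m]])
    show "(\<lambda>X. tensor_lift R P b (?W (tensor_map R M (A \<boxtimes>\<^bsub>R\<^esub> C) id \<psi>
        (tensor_assoc R M C A (pure_tensor R (M \<boxtimes>\<^bsub>R\<^esub> C) A X a))))) \<in> lin_hom R (M \<boxtimes>\<^bsub>R\<^esub> C) P"
      by (intro lin_hom_comp[OF tensor_lift_lin[OF mods(1,3) P b]] lin_hom_comp[OF W]
          lin_hom_comp[OF tensor_map_lin[OF mods(1,6,1,5) lin_hom_id \<psi>_hom]]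
          lin_hom_comp[OF tensor_assoc_lin] bilin_lin_left[OF pure_tensor_bilin] a mods lin_hom_ident)
  qed (simp add: id_def a tensor_assoc_pure mods pure_tensor_closed inner[unfolded id_def] psi_closed
      tensor_map_pure[OF mods(1,6,1,5) lin_hom_ident \<psi>_hom])
  then show ?thesis using coact_ract[OF m a] by simp
qed

end


section \<open>Averaging with a normalised integral map\<close>

text \<open>The map \<theta> in curried form, so that it can stand in the body of a lift.\<close>

definition integral_pairing ::
    "('k, 'r) ring_scheme \<Rightarrow> ('k, 'a, 'x) module_scheme \<Rightarrow> ('k, 'c, 'y) coalgebra_scheme
      \<Rightarrow> ('c \<Rightarrow> ('k, 'c \<Rightarrow> 'k, 'a) tensor) \<Rightarrow> 'c \<Rightarrow> 'c \<Rightarrow> 'a"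
  where "integral_pairing R A C \<phi> c d =
    ev_contract R A C (pure_tensor R C (dual_module R C \<boxtimes>\<^bsub>R\<^esub> A) c (\<phi> d))"

definition integral_act ::
    "('k, 'r) ring_scheme \<Rightarrow> ('k, 'a, 'x) module_scheme \<Rightarrow> ('k, 'c, 'y) coalgebra_scheme
      \<Rightarrow> ('c \<Rightarrow> ('k, 'c \<Rightarrow> 'k, 'a) tensor) \<Rightarrow> ('k, 'a, 'c, 'm, 'z) entwined_module_scheme
      \<Rightarrow> 'm \<Rightarrow> 'c \<Rightarrow> 'm"
  where "integral_act R A C \<phi> M m d =
    tensor_lift R M (\<lambda>n c. n \<bullet>\<^bsub>M\<^esub> integral_pairing R A C \<phi> c d) (coact M m)"

context normalised_integral_map
begin

abbreviation "\<theta> \<equiv> integral_pairing R A C \<phi>"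

lemma module_dual: "module R (dual_module R C)"
  by (rule module_dual_module[OF module_C])

text \<open>In instances of \<open>tensor_map_pure\<close> and \<open>tensor_map_lin\<close> the
  selected numbers name, in this order, the two domains and the two codomains.\<close>

lemmas integral_modules = module_A module_C module_dual module_base_module[OF R.is_cring]
  module_tensor[OF module_A module_C] module_tensor[OF module_C module_A]
  module_tensor[OF module_dual module_A] module_tensor[OF module_C module_C]
  module_tensor[OF module_A module_A] module_tensor[OF module_C module_dual]
  module_tensor[OF module_C module_tensor[OF module_dual module_A]]
  module_tensor[OF module_tensor[OF module_dual module_A] module_A]
  module_tensor[OF module_dual module_tensor[OF module_A module_A]]

lemma ev_contract_lin:
  "ev_contract R A C \<in> lin_hom R (C \<boxtimes>\<^bsub>R\<^esub> dual_module R C \<boxtimes>\<^bsub>R\<^esub> A) A"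
proof (rule lin_hom_eta)
  show "(\<lambda>x. ev_contract R A C x) \<in> lin_hom R (C \<boxtimes>\<^bsub>R\<^esub> dual_module R C \<boxtimes>\<^bsub>R\<^esub> A) A"
    unfolding ev_contract_def comp_def
    by (intro lin_hom_comp[OF module.tensor_lunit_lin] lin_hom_comp[OF tensor_map_lin tensor_assoc_inv_lin]
        integral_modules module.ev_map_lin lin_hom_id)
qed

lemma ev_contract_pure:
  assumes "c \<in> carrier C" "\<xi> \<in> carrier (dual_module R C)" "a \<in> carrier A"
  shows "ev_contract R A C (pure_tensor R C (dual_module R C \<boxtimes>\<^bsub>R\<^esub> A) c (pure_tensor R (dual_module R C) A \<xi> a)) =
    \<xi> c \<odot>\<^bsub>A\<^esub> a"
  using assms
  by (simp add: id_def ev_contract_def tensor_assoc_inv_pure integral_modules pure_tensor_closed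
      tensor_map_pure[OF integral_modules(10,1,4,1) module.ev_map_lin[OF module_C] lin_hom_ident]
      module.ev_map_pure[OF module_C] module.tensor_lunit_pure[OF module_A]
      module.dual_module_closed[OF module_C])

lemma pairing_bilin: "bilin R C C A \<theta>"
  unfolding integral_pairing_def
  by (rule lin_hom_comp_bilin[OF ev_contract_lin])
    (rule bilin_comp_lin[OF pure_tensor_bilin lin_hom_ident \<phi>_hom]; intro integral_modules)

lemmas pairing_closed = bilin_closed[OF pairing_bilin]

lemma phi_closed: "c \<in> carrier C \<Longrightarrow> \<phi> c \<in> carrier (dual_module R C \<boxtimes>\<^bsub>R\<^esub> A)"
  by (rule lin_hom_closed[OF \<phi>_hom])

text \<open>This is \<open>\<phi>_normalised\<close> in Sweedler form:
  \<open>\<theta>(c_1, c_2) = \<epsilon>(c) 1\<close>.\<close>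

lemma pairing_counit:
  assumes c: "c \<in> carrier C"
  shows "tensor_lift R A \<theta> (comult C c) = counit C c \<odot>\<^bsub>A\<^esub> \<one>\<^bsub>A\<^esub>"
proof -
  have "ev_contract R A C (tensor_map R C (dual_module R C \<boxtimes>\<^bsub>R\<^esub> A) id \<phi> (comult C c)) =
      tensor_lift R A \<theta> (comult C c)"
  proof (rule lin_hom_eq_tensor_lift[OF integral_modules(2,2,1) _ comult_closed[OF c]])
    show "(\<lambda>X. ev_contract R A C (tensor_map R C (dual_module R C \<boxtimes>\<^bsub>R\<^esub> A) id \<phi> X)) \<in> lin_hom R (C \<boxtimes>\<^bsub>R\<^esub> C) A"
      by (intro lin_hom_comp[OF ev_contract_lin] tensor_map_lin integral_modules lin_hom_id \<phi>_hom)
  qed (simp add: id_def tensor_map_pure[OF integral_modules(2,2,2,7) lin_hom_ident \<phi>_hom] integral_pairing_def)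
  then show ?thesis using \<phi>_normalised[OF c] by simp
qed

text \<open>This is \<open>\<phi>_coact\<close> at c \<otimes> d: \<open>\<psi>(c_1 \<otimes>
  \<theta>(c_2, d)) = \<theta>(c, d_1) \<otimes> d_2\<close>. It trades a comultiplication of c for
  one of d. The linear map h is built in because the application acts on a module element with the
  resulting tensor.\<close>

lemma pairing_coact:
  assumes P: "module R P" and h: "h \<in> lin_hom R (A \<boxtimes>\<^bsub>R\<^esub> C) P"
    and c: "c \<in> carrier C" and d: "d \<in> carrier C"
  shows "tensor_lift R P (\<lambda>c' c''. h (\<psi> (pure_tensor R C A c' (\<theta> c'' d)))) (comult C c) =
    tensor_lift R P (\<lambda>d' d''. h (pure_tensor R A C (\<theta> c d') d'')) (comult C d)"
proof -
  let ?D = "dual_module R C \<boxtimes>\<^bsub>R\<^esub> A"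
  note mods = integral_modules
  note tm = tensor_map_pure[OF mods(2,2,2,8) lin_hom_ident comult_hom]
    tensor_map_pure[OF mods(2,2,2,7) lin_hom_ident \<phi>_hom]
    tensor_map_pure[OF mods(8,2,11,2) tensor_map_lin[OF mods(2,2,2,7) lin_hom_ident \<phi>_hom] lin_hom_ident]
    tensor_map_pure[OF mods(11,2,1,2) ev_contract_lin lin_hom_ident]
    tensor_map_pure[OF mods(2,11,2,1) lin_hom_ident ev_contract_lin]
    tensor_map_pure[OF mods(2,2,8,7) comult_hom \<phi>_hom]
  \<comment> \<open>\<open>?L\<close> and \<open>?R\<close> are the sides of
    \<open>\<phi>_coact\<close> with the comultiplication replaced by a variable tensor; each is
    linear in it and can be expanded separately.\<close>
  let ?L = "\<lambda>Y. tensor_map R A C (ev_contract R A C) id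
    (tensor_map R (C \<boxtimes>\<^bsub>R\<^esub> ?D) C (tensor_map R C ?D id \<phi>) id
      (tensor_assoc_inv R C C C (pure_tensor R C (C \<boxtimes>\<^bsub>R\<^esub> C) c Y)))"
  let ?R = "\<lambda>X. \<psi> (tensor_map R C A id (ev_contract R A C)
    (tensor_assoc R C C ?D (pure_tensor R (C \<boxtimes>\<^bsub>R\<^esub> C) ?D X (\<phi> d))))"
  have "pure_tensor R C C c d \<in> carrier (C \<boxtimes>\<^bsub>R\<^esub> C)"
    by (intro pure_tensor_closed mods c d)
  from \<phi>_coact[OF this] have LR: "?L (comult C d) = ?R (comult C c)"
    using c d by (simp add: id_def tm comult_closed)
  have "h (?L (comult C d)) =
      tensor_lift R P (\<lambda>d' d''. h (pure_tensor R A C (\<theta> c d') d'')) (comult C d)"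
  proof (rule lin_hom_eq_tensor_lift[OF mods(2,2) P _ comult_closed[OF d]])
    show "(\<lambda>Y. h (?L Y)) \<in> lin_hom R (C \<boxtimes>\<^bsub>R\<^esub> C) P"
      by (intro lin_hom_comp[OF h] lin_hom_comp[OF tensor_map_lin[OF mods(11,2,1,2) ev_contract_lin lin_hom_id]]
          lin_hom_comp[OF tensor_map_lin[OF mods(8,2,11,2) tensor_map_lin[OF mods(2,2,2,7) lin_hom_id \<phi>_hom] lin_hom_id]]
          lin_hom_comp[OF tensor_assoc_inv_lin] bilin_lin_right[OF pure_tensor_bilin] c mods lin_hom_ident)
  qed (simp add: id_def c tensor_assoc_inv_pure mods tm pure_tensor_closed phi_closed integral_pairing_def)
  moreover have "h (?R (comult C c)) =
      tensor_lift R P (\<lambda>c' c''. h (\<psi> (pure_tensor R C A c' (\<theta> c'' d)))) (comult C c)"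
  proof (rule lin_hom_eq_tensor_lift[OF mods(2,2) P _ comult_closed[OF c]])
    show "(\<lambda>X. h (?R X)) \<in> lin_hom R (C \<boxtimes>\<^bsub>R\<^esub> C) P"
      by (intro lin_hom_comp[OF h] lin_hom_comp[OF \<psi>_hom]
          lin_hom_comp[OF tensor_map_lin[OF mods(2,11,2,1) lin_hom_id ev_contract_lin]]
          lin_hom_comp[OF tensor_assoc_lin] bilin_lin_left[OF pure_tensor_bilin] phi_closed d mods lin_hom_ident)
  qed (simp add: id_def d tensor_assoc_pure mods tm pure_tensor_closed phi_closed integral_pairing_def)
  ultimately show ?thesis using LR by simp
qed

text \<open>This is \<open>\<phi>_ract\<close> at c \<otimes> d \<otimes> a: moving a leftwards past
  d and then past c by \<psi> has the same effect as multiplying \<theta>(c, d) by a on the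
  right.\<close>

lemma pairing_ract:
  assumes c: "c \<in> carrier C" and d: "d \<in> carrier C" and a: "a \<in> carrier A"
  shows "tensor_lift R A (\<lambda>a' d'. tensor_lift R A (\<lambda>a'' c''. a'' \<otimes>\<^bsub>A\<^esub> \<theta> c'' d') (\<psi> (pure_tensor R C A c a')))
      (\<psi> (pure_tensor R C A d a)) = \<theta> c d \<otimes>\<^bsub>A\<^esub> a"
proof -
  let ?D = "dual_module R C \<boxtimes>\<^bsub>R\<^esub> A"
  note mods = integral_modules
  have idphi: "tensor_map R ?D A \<phi> (\<lambda>x. x) \<in> lin_hom R (C \<boxtimes>\<^bsub>R\<^esub> A) (?D \<boxtimes>\<^bsub>R\<^esub> A)"
    by (intro tensor_map_lin mods \<phi>_hom lin_hom_ident)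
  have assoc: "tensor_assoc R (dual_module R C) A A \<in> lin_hom R (?D \<boxtimes>\<^bsub>R\<^esub> A) (dual_module R C \<boxtimes>\<^bsub>R\<^esub> A \<boxtimes>\<^bsub>R\<^esub> A)"
    by (intro tensor_assoc_lin mods)
  note ev = module.ev_map_lin[OF module_C]
  note tm = tensor_map_pure[OF mods(2,6,2,5) lin_hom_ident \<psi>_hom]
    tensor_map_pure[OF mods(6,2,5,7) \<psi>_hom \<phi>_hom]
    tensor_map_pure[OF mods(1,11,1,1) lin_hom_ident ev_contract_lin]
    tensor_map_pure[OF mods(2,6,2,12) lin_hom_ident idphi]
    tensor_map_pure[OF mods(2,1,7,1) \<phi>_hom lin_hom_ident]
    tensor_map_pure[OF mods(2,12,2,13) lin_hom_ident assoc]
    tensor_map_pure[OF mods(10,9,4,1) ev mult_map_lin]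
  let ?X = "pure_tensor R C (C \<boxtimes>\<^bsub>R\<^esub> A) c (pure_tensor R C A d a)"
  let ?M = "\<lambda>Z. mult_map R A (tensor_map R A A id (ev_contract R A C) (tensor_assoc R A C ?D Z))"
  let ?L = "\<lambda>Y. ?M (tensor_map R (A \<boxtimes>\<^bsub>R\<^esub> C) ?D \<psi> \<phi>
    (tensor_assoc_inv R C A C (pure_tensor R C (A \<boxtimes>\<^bsub>R\<^esub> C) c Y)))"
  let ?R = "\<lambda>Z. tensor_lunit R A (tensor_map R (base_module R) A (ev_map R) (mult_map R A)
    (tensor_assoc_inv R C (dual_module R C) (A \<boxtimes>\<^bsub>R\<^esub> A)
      (pure_tensor R C (dual_module R C \<boxtimes>\<^bsub>R\<^esub> A \<boxtimes>\<^bsub>R\<^esub> A) c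
        (tensor_assoc R (dual_module R C) A A (pure_tensor R ?D A Z a)))))"
  have M: "?M \<in> lin_hom R ((A \<boxtimes>\<^bsub>R\<^esub> C) \<boxtimes>\<^bsub>R\<^esub> ?D) A"
    by (intro lin_hom_comp[OF mult_map_lin] lin_hom_comp[OF tensor_map_lin tensor_assoc_lin] mods
        lin_hom_id ev_contract_lin)
  have "?X \<in> carrier (C \<boxtimes>\<^bsub>R\<^esub> C \<boxtimes>\<^bsub>R\<^esub> A)"
    by (intro pure_tensor_closed mods c d a)
  from \<phi>_ract[OF this] have LR: "?L (\<psi> (pure_tensor R C A d a)) = ?R (\<phi> d)"
    using c d a by (simp add: id_def tm pure_tensor_closed mods psi_closed phi_closed lin_hom_closed[OF idphi])
  have inner: "?M (pure_tensor R (A \<boxtimes>\<^bsub>R\<^esub> C) ?D X (\<phi> d')) = tensor_lift R A (\<lambda>a'' c''. a'' \<otimes>\<^bsub>A\<^esub> \<theta> c'' d') X"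
    if X: "X \<in> carrier (A \<boxtimes>\<^bsub>R\<^esub> C)" and d': "d' \<in> carrier C" for X d'
  proof (rule lin_hom_eq_tensor_lift[OF mods(1,2,1) _ X])
    show "(\<lambda>X. ?M (pure_tensor R (A \<boxtimes>\<^bsub>R\<^esub> C) ?D X (\<phi> d'))) \<in> lin_hom R (A \<boxtimes>\<^bsub>R\<^esub> C) A"
      by (intro lin_hom_comp[OF M] bilin_lin_left[OF pure_tensor_bilin] phi_closed d' mods lin_hom_ident)
  qed (use d' in \<open>simp add: id_def tensor_assoc_pure mods tm phi_closed pure_tensor_closed mult_map_pure
      lin_hom_closed[OF ev_contract_lin] integral_pairing_def\<close>)
  have "?L (\<psi> (pure_tensor R C A d a)) = tensor_lift R A (\<lambda>a' d'. tensor_lift R A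
      (\<lambda>a'' c''. a'' \<otimes>\<^bsub>A\<^esub> \<theta> c'' d') (\<psi> (pure_tensor R C A c a'))) (\<psi> (pure_tensor R C A d a))"
  proof (rule lin_hom_eq_tensor_lift[OF mods(1,2,1) _ psi_closed[OF d a]])
    show "?L \<in> lin_hom R (A \<boxtimes>\<^bsub>R\<^esub> C) A"
      by (intro lin_hom_comp[OF M] lin_hom_comp[OF tensor_map_lin[OF mods(6,2,5,7) \<psi>_hom \<phi>_hom]]
          lin_hom_comp[OF tensor_assoc_inv_lin] bilin_lin_right[OF pure_tensor_bilin] c mods lin_hom_ident)
  qed (simp add: id_def c tensor_assoc_inv_pure mods tm pure_tensor_closed inner[unfolded id_def] psi_closed)
  \<comment> \<open>Since \<phi>(d) need not be pure, both sides are compared as linear maps of an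
    arbitrary tensor in its place; on \<xi> \<otimes> b each gives \<xi>(c) b a.\<close>
  moreover have "?R (\<phi> d) = \<theta> c d \<otimes>\<^bsub>A\<^esub> a"
    unfolding integral_pairing_def
  proof (rule lin_hom_tensor_eqI[OF mods(3,1,1) _ _ _ phi_closed[OF d]])
    show "?R \<in> lin_hom R ?D A"
      by (intro lin_hom_comp[OF module.tensor_lunit_lin] lin_hom_comp[OF tensor_map_lin[OF mods(10,9,4,1) ev mult_map_lin]]
          lin_hom_comp[OF tensor_assoc_inv_lin] lin_hom_comp[OF assoc] bilin_lin_right[OF pure_tensor_bilin]
          bilin_lin_left[OF pure_tensor_bilin] c a mods lin_hom_ident)
    show "(\<lambda>Z. ev_contract R A C (pure_tensor R C ?D c Z) \<otimes>\<^bsub>A\<^esub> a) \<in> lin_hom R ?D A"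
      by (intro bilin_lin_left[OF mult_bilin a] lin_hom_comp[OF ev_contract_lin]
          bilin_lin_right[OF pure_tensor_bilin] c mods lin_hom_ident)
    fix \<xi> b assume "\<xi> \<in> carrier (dual_module R C)" "b \<in> carrier A"
    then show "?R (pure_tensor R (dual_module R C) A \<xi> b) =
        ev_contract R A C (pure_tensor R C ?D c (pure_tensor R (dual_module R C) A \<xi> b)) \<otimes>\<^bsub>A\<^esub> a"
      using c a by (simp add: id_def tensor_assoc_pure tensor_assoc_inv_pure mods tm pure_tensor_closed
          mult_map_pure module.ev_map_pure[OF module_C] module.tensor_lunit_pure[OF module_A]
          module.dual_module_closed[OF module_C] ev_contract_pure smult_mult_left)
  qed
  ultimately show ?thesis using LR by simp
qed

end

section \<open>The natural splitting of the coaction of an entwined module\<close>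

locale integral_entwined_module =
  normalised_integral_map R A C \<psi> \<phi> + entwined_module R A C \<psi> M
  for R (structure) and A (structure) and C (structure) and \<psi> and \<phi> and M (structure)
begin

abbreviation "act \<equiv> integral_act R A C \<phi> M"

lemmas entwined_modules = module_M module_A module_C module_tensor[OF module_M module_C]

lemma ract_pairing_bilin: "d \<in> carrier C \<Longrightarrow> bilin R M C M (\<lambda>n c. n \<bullet>\<^bsub>M\<^esub> \<theta> c d)"
  by (intro bilin_comp_lin[OF ract_bilin] bilin_lin_left[OF pairing_bilin] lin_hom_ident)

lemma ract_pairing_lin: "\<lbrakk>n \<in> carrier M; c \<in> carrier C\<rbrakk> \<Longrightarrow> (\<lambda>d. n \<bullet>\<^bsub>M\<^esub> \<theta> c d) \<in> lin_hom R C M"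
  by (intro bilin_lin_right[OF ract_bilin] bilin_lin_right[OF pairing_bilin] lin_hom_ident)

lemma act_bilin: "bilin R M C M act"
  unfolding integral_act_def
  by (intro bilinI tensor_lift_lin_arg[OF ract_pairing_bilin coact_hom]
      tensor_lift_lin_body[OF entwined_modules(1,3,1)] ract_pairing_lin coact_closed entwined_modules)

lemmas act_closed = bilin_closed[OF act_bilin]

text \<open>Right A-linearity of \<open>E\<close> for the action (m \<otimes> d) a = m a_\<alpha>
  \<otimes> d^\<alpha>. The coaction of m a_\<alpha> produces a second \<psi>, and the two are
  absorbed by \<open>pairing_ract\<close>.\<close>

lemma act_psi:
  assumes m: "m \<in> carrier M" and d: "d \<in> carrier C" and a: "a \<in> carrier A"
  shows "tensor_lift R M (\<lambda>a' d'. act (m \<bullet>\<^bsub>M\<^esub> a') d') (\<psi> (pure_tensor R C A d a)) = act m d \<bullet>\<^bsub>M\<^esub> a"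
proof -
  note mods = entwined_modules
  note X = psi_closed[OF d a] and Y = coact_closed[OF m]
  let ?b = "\<lambda>n c a' d'. tensor_lift R M (\<lambda>a'' c''. (n \<bullet>\<^bsub>M\<^esub> a'') \<bullet>\<^bsub>M\<^esub> \<theta> c'' d') (\<psi> (pure_tensor R C A c a'))"
  have inner: "bilin R A C M (\<lambda>a'' c''. (n \<bullet>\<^bsub>M\<^esub> a'') \<bullet>\<^bsub>M\<^esub> \<theta> c'' d')"
    if "n \<in> carrier M" "d' \<in> carrier C" for n d'
    using that by (intro bilin_comp_lin[OF ract_bilin] bilin_lin_right[OF ract_bilin]
        bilin_lin_left[OF pairing_bilin] lin_hom_ident)
  have psi: "(\<lambda>a'. \<psi> (pure_tensor R C A c a')) \<in> lin_hom R A (A \<boxtimes>\<^bsub>R\<^esub> C)" if "c \<in> carrier C" for c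
    using that by (intro lin_hom_comp[OF \<psi>_hom] bilin_lin_right[OF pure_tensor_bilin] mods lin_hom_ident)
  have outer: "bilin R A C M (?b n c)" if "n \<in> carrier M" "c \<in> carrier C" for n c
    using that by (intro bilinI tensor_lift_lin_arg[OF inner psi] tensor_lift_lin_body[OF mods(2,3,1)]
        ract_pairing_lin ract_closed psi_closed mods)
  have mult_inner: "bilin R A C A (\<lambda>a'' c''. a'' \<otimes>\<^bsub>A\<^esub> \<theta> c'' d')" if "d' \<in> carrier C" for d'
    using that by (intro bilin_comp_lin[OF mult_bilin] bilin_lin_left[OF pairing_bilin] lin_hom_ident)
  have mult_outer: "bilin R A C A (\<lambda>a' d'. tensor_lift R A (\<lambda>a'' c''. a'' \<otimes>\<^bsub>A\<^esub> \<theta> c'' d') (\<psi> (pure_tensor R C A c a')))"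
    if "c \<in> carrier C" for c
    using that by (intro bilinI tensor_lift_lin_arg[OF mult_inner psi] tensor_lift_lin_body[OF mods(2,3,2)]
        bilin_lin_right[OF mult_bilin] bilin_lin_right[OF pairing_bilin] psi_closed mods lin_hom_ident)
  have ract: "(\<lambda>x. n \<bullet>\<^bsub>M\<^esub> x) \<in> lin_hom R A M" if "n \<in> carrier M" for n
    using that by (intro bilin_lin_right[OF ract_bilin] lin_hom_ident)
  have "tensor_lift R M (\<lambda>a' d'. act (m \<bullet>\<^bsub>M\<^esub> a') d') (\<psi> (pure_tensor R C A d a)) =
      tensor_lift R M (\<lambda>a' d'. tensor_lift R M (\<lambda>n c. ?b n c a' d') (coact M m)) (\<psi> (pure_tensor R C A d a))"
  proof (rule tensor_lift_cong[OF mods(2,3,1) _ _ X])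
    fix a' d' assume a': "a' \<in> carrier A" and d': "d' \<in> carrier C"
    show "act (m \<bullet>\<^bsub>M\<^esub> a') d' \<in> carrier M"
      by (intro act_closed ract_closed m a' d')
    show "act (m \<bullet>\<^bsub>M\<^esub> a') d' = tensor_lift R M (\<lambda>n c. ?b n c a' d') (coact M m)"
      unfolding integral_act_def by (rule coact_ract_lift[OF mods(1) ract_pairing_bilin[OF d'] m a'])
  qed
  also have "\<dots> = tensor_lift R M (\<lambda>n c. tensor_lift R M (?b n c) (\<psi> (pure_tensor R C A d a))) (coact M m)"
    \<comment> \<open>With the sum over the coaction of m outermost, n and c are fixed, and the
      remaining double sum over \<psi> is the one in \<open>pairing_ract\<close> acting on
      n.\<close>
    by (rule tensor_lift_swap[OF mods(2,3,1,3,1) outer X Y])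
  also have "\<dots> = tensor_lift R M (\<lambda>n c. (n \<bullet>\<^bsub>M\<^esub> \<theta> c d) \<bullet>\<^bsub>M\<^esub> a) (coact M m)"
  proof (rule tensor_lift_cong[OF mods(1,3,1) _ _ Y])
    fix n c assume n: "n \<in> carrier M" and c: "c \<in> carrier C"
    show "tensor_lift R M (?b n c) (\<psi> (pure_tensor R C A d a)) \<in> carrier M"
      by (rule lin_hom_closed[OF tensor_lift_lin[OF mods(2,3,1) outer[OF n c]] X])
    have "?b n c a' d' = n \<bullet>\<^bsub>M\<^esub> tensor_lift R A (\<lambda>a'' c''. a'' \<otimes>\<^bsub>A\<^esub> \<theta> c'' d') (\<psi> (pure_tensor R C A c a'))"
      if a': "a' \<in> carrier A" and d': "d' \<in> carrier C" for a' d'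
      unfolding tensor_lift_commute[OF mods(2,3,2,1) ract[OF n] mult_inner[OF d'] psi_closed[OF c a']]
      using n d' c a' by (intro tensor_lift_cong[OF mods(2,3,1)])
        (auto simp: ract_mult pairing_closed ract_closed psi_closed)
    then have "tensor_lift R M (?b n c) (\<psi> (pure_tensor R C A d a)) =
        tensor_lift R M (\<lambda>a' d'. n \<bullet>\<^bsub>M\<^esub> tensor_lift R A (\<lambda>a'' c''. a'' \<otimes>\<^bsub>A\<^esub> \<theta> c'' d')
          (\<psi> (pure_tensor R C A c a'))) (\<psi> (pure_tensor R C A d a))"
      by (intro tensor_lift_cong[OF mods(2,3,1) bilin_closed[OF outer[OF n c]] _ X])
    also have "\<dots> = n \<bullet>\<^bsub>M\<^esub> (\<theta> c d \<otimes>\<^bsub>A\<^esub> a)"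
      by (simp add: tensor_lift_commute[OF mods(2,3,2,1) ract[OF n] mult_outer[OF c] X, symmetric]
          pairing_ract[OF c d a])
    also have "\<dots> = (n \<bullet>\<^bsub>M\<^esub> \<theta> c d) \<bullet>\<^bsub>M\<^esub> a"
      using n c d a by (simp add: ract_mult pairing_closed)
    finally show "tensor_lift R M (?b n c) (\<psi> (pure_tensor R C A d a)) = (n \<bullet>\<^bsub>M\<^esub> \<theta> c d) \<bullet>\<^bsub>M\<^esub> a" .
  qed
  also have "\<dots> = act m d \<bullet>\<^bsub>M\<^esub> a"
    unfolding integral_act_def
    by (rule tensor_lift_commute[OF mods(1,3,1,1) bilin_lin_left[OF ract_bilin a lin_hom_ident]
          ract_pairing_bilin[OF d] Y, symmetric])
  finally show ?thesis .
qed

text \<open>Colinearity of \<open>E\<close> for the coaction of M \<otimes> C on the second factor.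
  Coassociativity replaces the coaction of m_0 by a comultiplication of m_1, and
  \<open>pairing_coact\<close> moves that comultiplication over to d.\<close>

lemma coact_act:
  assumes m: "m \<in> carrier M" and d: "d \<in> carrier C"
  shows "coact M (act m d) =
    tensor_lift R (M \<boxtimes>\<^bsub>R\<^esub> C) (\<lambda>d' d''. pure_tensor R M C (act m d') d'') (comult C d)"
proof -
  note mods = entwined_modules
  note X = coact_closed[OF m] and Y = comult_closed[OF d]
  note pure = pure_tensor_bilin[OF mods(1,3)]
  let ?T = "M \<boxtimes>\<^bsub>R\<^esub> C"
  let ?h = "\<lambda>n. tensor_lift R ?T (\<lambda>a c. pure_tensor R M C (n \<bullet>\<^bsub>M\<^esub> a) c)"
  \<comment> \<open>The summand obtained from the entwining compatibility applied to n \<theta>(c,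
    d): here c' is the leg that passes through \<psi> and c the leg already paired with d.\<close>
  let ?b = "\<lambda>n c' c. ?h n (\<psi> (pure_tensor R C A c' (\<theta> c d)))"
  have h_bilin: "bilin R A C ?T (\<lambda>a c. pure_tensor R M C (n \<bullet>\<^bsub>M\<^esub> a) c)" if "n \<in> carrier M" for n
    using that by (intro bilin_comp_lin[OF pure] bilin_lin_right[OF ract_bilin] lin_hom_ident)
  have h: "?h n \<in> lin_hom R (A \<boxtimes>\<^bsub>R\<^esub> C) ?T" if "n \<in> carrier M" for n
    by (rule tensor_lift_lin[OF mods(2,3,4) h_bilin[OF that]])
  have b1: "bilin R C C ?T (?b n)" if "n \<in> carrier M" for n
    using that d
    by (intro lin_hom_comp_bilin[OF h] lin_hom_comp_bilin[OF \<psi>_hom] bilin_comp_lin[OF pure_tensor_bilin]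
        bilin_lin_left[OF pairing_bilin] mods lin_hom_ident)
  have b2: "(\<lambda>n. ?b n c' c) \<in> lin_hom R M ?T" if "c' \<in> carrier C" "c \<in> carrier C" for c' c
    using that d by (intro tensor_lift_lin_body[OF mods(2,3,4)] bilin_lin_left[OF pure]
        bilin_lin_left[OF ract_bilin] psi_closed pairing_closed lin_hom_ident)
  have sw: "bilin R M C ?T (\<lambda>n c. pure_tensor R M C (n \<bullet>\<^bsub>M\<^esub> \<theta> c d') d'')"
    if "d' \<in> carrier C" "d'' \<in> carrier C" for d' d''
    by (rule lin_hom_comp_bilin[OF bilin_lin_left[OF pure that(2) lin_hom_ident]
          ract_pairing_bilin[OF that(1)]])
  have "coact M (act m d) = tensor_lift R ?T (\<lambda>n c. coact M (n \<bullet>\<^bsub>M\<^esub> \<theta> c d)) (coact M m)"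
    unfolding integral_act_def
    by (rule tensor_lift_commute[OF mods(1,3,1,4) coact_hom ract_pairing_bilin[OF d] X])
  also have "\<dots> = tensor_lift R ?T (\<lambda>n c. tensor_lift R ?T (\<lambda>n' c'. ?b n' c' c) (coact M n)) (coact M m)"
  proof (rule tensor_lift_cong[OF mods(1,3,4) _ _ X])
    fix n c assume n: "n \<in> carrier M" and c: "c \<in> carrier C"
    have cl: "n \<bullet>\<^bsub>M\<^esub> \<theta> c d \<in> carrier M" by (intro ract_closed pairing_closed n c d)
    then show "coact M (n \<bullet>\<^bsub>M\<^esub> \<theta> c d) \<in> carrier ?T" by (rule coact_closed)
    have "coact M (n \<bullet>\<^bsub>M\<^esub> \<theta> c d) = tensor_lift R ?T (pure_tensor R M C) (coact M (n \<bullet>\<^bsub>M\<^esub> \<theta> c d))"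
      by (rule tensor_lift_pure_tensor[OF mods(1,3) coact_closed[OF cl], symmetric])
    also have "\<dots> = tensor_lift R ?T (\<lambda>n' c'. ?b n' c' c) (coact M n)"
      by (rule coact_ract_lift[OF mods(4) pure n pairing_closed[OF c d]])
    finally show "coact M (n \<bullet>\<^bsub>M\<^esub> \<theta> c d) = \<dots>" .
  qed
  also have "\<dots> = tensor_lift R ?T (\<lambda>n c. tensor_lift R ?T (?b n) (comult C c)) (coact M m)"
    by (rule coact_coassoc_lift[OF mods(4) m b1 b2])
  also have "\<dots> = tensor_lift R ?T (\<lambda>n c. tensor_lift R ?T
      (\<lambda>d' d''. pure_tensor R M C (n \<bullet>\<^bsub>M\<^esub> \<theta> c d') d'') (comult C d)) (coact M m)"
  proof (rule tensor_lift_cong[OF mods(1,3,4) _ _ X])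
    fix n c assume n: "n \<in> carrier M" and c: "c \<in> carrier C"
    show "tensor_lift R ?T (?b n) (comult C c) \<in> carrier ?T"
      by (rule lin_hom_closed[OF tensor_lift_lin[OF mods(3,3,4) b1[OF n]] comult_closed[OF c]])
    have "tensor_lift R ?T (?b n) (comult C c) =
        tensor_lift R ?T (\<lambda>d' d''. ?h n (pure_tensor R A C (\<theta> c d') d'')) (comult C d)"
      by (rule pairing_coact[OF mods(4) h[OF n] c d])
    also have "\<dots> = tensor_lift R ?T (\<lambda>d' d''. pure_tensor R M C (n \<bullet>\<^bsub>M\<^esub> \<theta> c d') d'') (comult C d)"
      using n c by (intro tensor_lift_cong[OF mods(3,3,4) _ _ Y])
        (simp_all add: tensor_lift_pure[OF mods(2,3,4) h_bilin] pairing_closed pure_tensor_closed mods ract_closed)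
    finally show "tensor_lift R ?T (?b n) (comult C c) = \<dots>" .
  qed
  also have "\<dots> = tensor_lift R ?T (\<lambda>d' d''. tensor_lift R ?T
      (\<lambda>n c. pure_tensor R M C (n \<bullet>\<^bsub>M\<^esub> \<theta> c d') d'') (coact M m)) (comult C d)"
    \<comment> \<open>Now the sum over the coaction of m can be completed to \<open>act m d'\<close>
      for each fixed pair of legs of d.\<close>
    by (rule tensor_lift_swap[OF mods(1,3,3,3,4) sw X Y])
  also have "\<dots> = tensor_lift R ?T (\<lambda>d' d''. pure_tensor R M C (act m d') d'') (comult C d)"
  proof (rule tensor_lift_cong[OF mods(3,3,4) _ _ Y])
    fix d' d'' assume d': "d' \<in> carrier C" and d'': "d'' \<in> carrier C"
    show "tensor_lift R ?T (\<lambda>n c. pure_tensor R M C (n \<bullet>\<^bsub>M\<^esub> \<theta> c d') d'') (coact M m) \<in> carrier ?T"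
      by (rule lin_hom_closed[OF tensor_lift_lin[OF mods(1,3,4) sw[OF d' d'']] X])
    show "tensor_lift R ?T (\<lambda>n c. pure_tensor R M C (n \<bullet>\<^bsub>M\<^esub> \<theta> c d') d'') (coact M m) =
        pure_tensor R M C (act m d') d''"
      unfolding integral_act_def
      by (rule tensor_lift_commute[OF mods(1,3,1,4) bilin_lin_left[OF pure d'' lin_hom_ident]
            ract_pairing_bilin[OF d'] X, symmetric])
  qed
  finally show ?thesis .
qed

text \<open>By coassociativity the composite is \<open>m_0 \<theta>(m_1, m_2)\<close>; normalisation
  collapses the pairing to the counit, and the counit axiom returns m.\<close>

lemma act_coact:
  assumes m: "m \<in> carrier M"
  shows "tensor_lift R M act (coact M m) = m"
proof -
  note mods = entwined_modules
  note X = coact_closed[OF m]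
  have b: "bilin R C C M (\<lambda>c d. n \<bullet>\<^bsub>M\<^esub> \<theta> c d)" if "n \<in> carrier M" for n
    by (rule lin_hom_comp_bilin[OF bilin_lin_right[OF ract_bilin that lin_hom_ident] pairing_bilin])
  have b': "(\<lambda>n. n \<bullet>\<^bsub>M\<^esub> \<theta> c d) \<in> lin_hom R M M" if "c \<in> carrier C" "d \<in> carrier C" for c d
    using that by (intro bilin_lin_left[OF ract_bilin] pairing_closed lin_hom_ident)
  have "tensor_lift R M act (coact M m) =
      tensor_lift R M (\<lambda>n d. tensor_lift R M (\<lambda>c d. n \<bullet>\<^bsub>M\<^esub> \<theta> c d) (comult C d)) (coact M m)"
    unfolding integral_act_def by (rule coact_coassoc_lift[OF mods(1) m b b'])
  also have "\<dots> = tensor_lift R M (\<lambda>n d. counit C d \<odot>\<^bsub>M\<^esub> n) (coact M m)"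
  proof (rule tensor_lift_cong[OF mods(1,3,1) _ _ X])
    fix n d assume n: "n \<in> carrier M" and d: "d \<in> carrier C"
    show "tensor_lift R M (\<lambda>c d. n \<bullet>\<^bsub>M\<^esub> \<theta> c d) (comult C d) \<in> carrier M"
      by (rule lin_hom_closed[OF tensor_lift_lin[OF mods(3,3,1) b[OF n]] comult_closed[OF d]])
    have "tensor_lift R M (\<lambda>c d. n \<bullet>\<^bsub>M\<^esub> \<theta> c d) (comult C d) = n \<bullet>\<^bsub>M\<^esub> tensor_lift R A \<theta> (comult C d)"
      by (rule tensor_lift_commute[OF mods(3,3,2,1) bilin_lin_right[OF ract_bilin n lin_hom_ident]
            pairing_bilin comult_closed[OF d], symmetric])
    also have "\<dots> = counit C d \<odot>\<^bsub>M\<^esub> n"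
      using n d by (simp add: pairing_counit ract_smult_right ract_one counit_closed)
    finally show "tensor_lift R M (\<lambda>c d. n \<bullet>\<^bsub>M\<^esub> \<theta> c d) (comult C d) = counit C d \<odot>\<^bsub>M\<^esub> n" .
  qed
  also have "\<dots> = m" by (rule coact_counit_lift[OF m])
  finally show ?thesis .
qed

end

section \<open>Averaging right A-linear maps\<close>

definition integral_average ::
    "('k, 'r) ring_scheme \<Rightarrow> ('k, 'a, 'x) module_scheme \<Rightarrow> ('k, 'c, 'y) coalgebra_scheme
      \<Rightarrow> ('c \<Rightarrow> ('k, 'c \<Rightarrow> 'k, 'a) tensor) \<Rightarrow> ('k, 'a, 'c, 'm, 'z) entwined_module_scheme
      \<Rightarrow> ('k, 'a, 'c, 'n, 'w) entwined_module_scheme \<Rightarrow> ('m \<Rightarrow> 'n) \<Rightarrow> 'm \<Rightarrow> 'n"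
  where "integral_average R A C \<phi> M N g m =
    tensor_lift R N (\<lambda>m' c. integral_act R A C \<phi> N (g m') c) (coact M m)"

context
  fixes R A C \<psi> \<phi> M N
  assumes M: "integral_entwined_module R A C \<psi> \<phi> M" and N: "integral_entwined_module R A C \<psi> \<phi> N"
begin

interpretation M: integral_entwined_module R A C \<psi> \<phi> M by (rule M)
interpretation N: integral_entwined_module R A C \<psi> \<phi> N by (rule N)

private lemmas mods = M.module_M N.module_M M.module_A M.module_C module_tensor[OF M.module_M M.module_C]
  module_tensor[OF N.module_M M.module_C]

lemma entwined_hom_lin: "f \<in> entwined_hom R A C M N \<Longrightarrow> f \<in> lin_hom R M N"
  by (simp add: entwined_hom_def right_module_hom_def)

text \<open>Naturality of \<open>E\<close>: colinearity rewrites the coaction of f m through that of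
  m, and A-linearity lets f pass the action of \<theta>.\<close>

lemma entwined_hom_integral_act:
  assumes f: "f \<in> entwined_hom R A C M N" and m: "m \<in> carrier M" and d: "d \<in> carrier C"
  shows "integral_act R A C \<phi> N (f m) d = f (integral_act R A C \<phi> M m d)"
proof -
  note X = M.coact_closed[OF m] and lin = entwined_hom_lin[OF f]
  have "integral_act R A C \<phi> N (f m) d =
      tensor_lift R N (\<lambda>n c. n \<bullet>\<^bsub>N\<^esub> M.\<theta> c d) (tensor_map R N C f id (coact M m))"
    using f m by (simp add: integral_act_def entwined_hom_def)
  also have "\<dots> = tensor_lift R N (\<lambda>n c. f n \<bullet>\<^bsub>N\<^esub> M.\<theta> (id c) d) (coact M m)"
    by (rule tensor_lift_tensor_map[OF mods(1,4,2,4) lin lin_hom_id mods(2) N.ract_pairing_bilin[OF d] X])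
  also have "\<dots> = tensor_lift R N (\<lambda>n c. f (n \<bullet>\<^bsub>M\<^esub> M.\<theta> c d)) (coact M m)"
    using f d by (intro tensor_lift_cong[OF mods(1,4,2) _ _ X])
      (auto simp: entwined_hom_def right_module_hom_def M.pairing_closed
        intro!: N.ract_closed lin_hom_closed[OF lin])
  also have "\<dots> = f (integral_act R A C \<phi> M m d)"
    unfolding integral_act_def
    by (rule tensor_lift_commute[OF mods(1,4,1,2) lin M.ract_pairing_bilin[OF d] X, symmetric])
  finally show ?thesis .
qed

context
  fixes g
  assumes g: "g \<in> right_module_hom R A M N"
begin

private lemma g_lin: "g \<in> lin_hom R M N"
  using g by (simp add: right_module_hom_def)

lemma integral_average_bilin: "bilin R M C N (\<lambda>m c. integral_act R A C \<phi> N (g m) c)"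
  by (rule bilin_comp_lin[OF N.act_bilin g_lin lin_hom_ident])

lemma integral_average_lin: "integral_average R A C \<phi> M N g \<in> lin_hom R M N"
  by (rule lin_hom_eta, unfold integral_average_def)
    (intro tensor_lift_lin_arg[OF integral_average_bilin M.coact_hom] mods)

text \<open>The factor a passes the coaction of M by the entwining compatibility, then g by
  A-linearity, then \<open>E\<close> by \<open>act_psi\<close>.\<close>

lemma integral_average_ract:
  assumes m: "m \<in> carrier M" and a: "a \<in> carrier A"
  shows "integral_average R A C \<phi> M N g (m \<bullet>\<^bsub>M\<^esub> a) = integral_average R A C \<phi> M N g m \<bullet>\<^bsub>N\<^esub> a"
proof -
  note X = M.coact_closed[OF m]
  have "integral_average R A C \<phi> M N g (m \<bullet>\<^bsub>M\<^esub> a) = tensor_lift R N (\<lambda>n c. tensor_lift R N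
      (\<lambda>a' c'. N.act (g (n \<bullet>\<^bsub>M\<^esub> a')) c') (\<psi> (pure_tensor R C A c a))) (coact M m)"
    unfolding integral_average_def by (rule M.coact_ract_lift[OF mods(2) integral_average_bilin m a])
  also have "\<dots> = tensor_lift R N (\<lambda>n c. N.act (g n) c \<bullet>\<^bsub>N\<^esub> a) (coact M m)"
  proof (rule tensor_lift_cong[OF mods(1,4,2) _ _ X])
    fix n c assume n: "n \<in> carrier M" and c: "c \<in> carrier C"
    have gn: "g n \<in> carrier N" by (rule lin_hom_closed[OF g_lin n])
    have "tensor_lift R N (\<lambda>a' c'. N.act (g (n \<bullet>\<^bsub>M\<^esub> a')) c') (\<psi> (pure_tensor R C A c a)) =
        tensor_lift R N (\<lambda>a' c'. N.act (g n \<bullet>\<^bsub>N\<^esub> a') c') (\<psi> (pure_tensor R C A c a))"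
      using g n by (intro tensor_lift_cong[OF mods(3,4,2) _ _ M.psi_closed[OF c a]])
        (auto simp: right_module_hom_def intro!: N.act_closed N.ract_closed gn)
    also have "\<dots> = N.act (g n) c \<bullet>\<^bsub>N\<^esub> a" by (rule N.act_psi[OF gn c a])
    finally show *: "tensor_lift R N (\<lambda>a' c'. N.act (g (n \<bullet>\<^bsub>M\<^esub> a')) c') (\<psi> (pure_tensor R C A c a)) =
        N.act (g n) c \<bullet>\<^bsub>N\<^esub> a" .
    show "tensor_lift R N (\<lambda>a' c'. N.act (g (n \<bullet>\<^bsub>M\<^esub> a')) c') (\<psi> (pure_tensor R C A c a)) \<in> carrier N"
      unfolding * by (intro N.ract_closed N.act_closed gn c a)
  qed
  also have "\<dots> = integral_average R A C \<phi> M N g m \<bullet>\<^bsub>N\<^esub> a"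
    unfolding integral_average_def
    by (rule tensor_lift_commute[OF mods(1,4,2,2) bilin_lin_left[OF N.ract_bilin a lin_hom_ident]
          integral_average_bilin X, symmetric])
  finally show ?thesis .
qed

text \<open>Although g need not be colinear, the average is: \<open>coact_act\<close> moves the
  coaction onto the C-factor, which comes from M, and coassociativity of M, read backwards,
  finishes.\<close>

lemma integral_average_coact:
  assumes m: "m \<in> carrier M"
  shows "coact N (integral_average R A C \<phi> M N g m) =
    tensor_map R N C (integral_average R A C \<phi> M N g) id (coact M m)"
proof -
  let ?T = "N \<boxtimes>\<^bsub>R\<^esub> C"
  let ?b = "\<lambda>n d' d''. pure_tensor R N C (N.act (g n) d') d''"
  note X = M.coact_closed[OF m]
  note pure = pure_tensor_bilin[OF mods(2,4)]
  have b1: "bilin R C C ?T (?b n)" if "n \<in> carrier M" for n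
    using that by (intro bilin_comp_lin[OF pure] bilin_lin_right[OF N.act_bilin] lin_hom_ident
        lin_hom_closed[OF g_lin])
  have b2: "(\<lambda>n. ?b n d' d'') \<in> lin_hom R M ?T" if "d' \<in> carrier C" "d'' \<in> carrier C" for d' d''
    using that by (intro bilin_lin_left[OF pure] bilin_lin_left[OF N.act_bilin] g_lin)
  have "coact N (integral_average R A C \<phi> M N g m) =
      tensor_lift R ?T (\<lambda>n c. coact N (N.act (g n) c)) (coact M m)"
    unfolding integral_average_def
    by (rule tensor_lift_commute[OF mods(1,4,2,6) N.coact_hom integral_average_bilin X])
  also have "\<dots> = tensor_lift R ?T (\<lambda>n d. tensor_lift R ?T (?b n) (comult C d)) (coact M m)"
    by (intro tensor_lift_cong[OF mods(1,4,6) _ _ X] N.coact_act N.coact_closed N.act_closed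
        lin_hom_closed[OF g_lin])
  also have "\<dots> = tensor_lift R ?T (\<lambda>n d. tensor_lift R ?T (\<lambda>n' c. ?b n' c d) (coact M n)) (coact M m)"
    by (rule M.coact_coassoc_lift[OF mods(6) m b1 b2, symmetric])
  \<comment> \<open>The inert \<open>id\<close> makes the summand literally the body of
    \<open>tensor_map\<close>, so the last step is an unfolding.\<close>
  also have "\<dots> = tensor_lift R ?T (\<lambda>n d. pure_tensor R N C (integral_average R A C \<phi> M N g n) (id d)) (coact M m)"
  proof (rule tensor_lift_cong[OF mods(1,4,6) _ _ X])
    fix n d assume n: "n \<in> carrier M" and d: "d \<in> carrier C"
    show *: "tensor_lift R ?T (\<lambda>n' c. ?b n' c d) (coact M n) =
        pure_tensor R N C (integral_average R A C \<phi> M N g n) (id d)"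
      unfolding integral_average_def id_apply
      by (rule tensor_lift_commute[OF mods(1,4,2,6) bilin_lin_left[OF pure d lin_hom_ident]
            integral_average_bilin M.coact_closed[OF n], symmetric])
    show "tensor_lift R ?T (\<lambda>n' c. ?b n' c d) (coact M n) \<in> carrier ?T"
      unfolding * id_apply
      by (intro pure_tensor_closed mods lin_hom_closed[OF integral_average_lin] n d)
  qed
  also have "\<dots> = tensor_map R N C (integral_average R A C \<phi> M N g) id (coact M m)"
    by (simp add: tensor_map_def)
  finally show ?thesis .
qed

lemma integral_average_entwined_hom: "integral_average R A C \<phi> M N g \<in> entwined_hom R A C M N"
  using integral_average_lin integral_average_ract integral_average_coact
  by (simp add: entwined_hom_def right_module_hom_def)

end

end

section \<open>Transfer of sections and retractions\<close>

lemma integral_average_section: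
  assumes M: "integral_entwined_module R A C \<psi> \<phi> M" and N: "integral_entwined_module R A C \<psi> \<phi> N"
    and f: "f \<in> entwined_hom R A C N M" and g: "g \<in> right_module_hom R A M N"
    and fg: "\<And>m. m \<in> carrier M \<Longrightarrow> f (g m) = m" and m: "m \<in> carrier M"
  shows "f (integral_average R A C \<phi> M N g m) = m"
proof -
  interpret M: integral_entwined_module R A C \<psi> \<phi> M by (rule M)
  interpret N: integral_entwined_module R A C \<psi> \<phi> N by (rule N)
  note mods = M.module_M N.module_M M.module_C and X = M.coact_closed[OF m]
  have g_closed: "g x \<in> carrier N" if "x \<in> carrier M" for x
    using g that by (auto simp: right_module_hom_def intro: lin_hom_closed)
  \<comment> \<open>After f has entered the sum, naturality carries it inside \<open>E\<close>,
    where f (g n) = n; what remains is \<open>act_coact\<close> for M.\<close>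
  have "f (integral_average R A C \<phi> M N g m) = tensor_lift R M (\<lambda>n c. f (N.act (g n) c)) (coact M m)"
    unfolding integral_average_def
    by (rule tensor_lift_commute[OF mods(1,3,2,1) entwined_hom_lin[OF N M f]
          integral_average_bilin[OF M N g] X])
  also have "\<dots> = tensor_lift R M M.act (coact M m)"
    by (intro tensor_lift_cong[OF mods(1,3,1) _ _ X])
      (simp_all add: entwined_hom_integral_act[OF N M f, symmetric] g_closed fg M.act_closed)
  also have "\<dots> = m" by (rule M.act_coact[OF m])
  finally show ?thesis .
qed

text \<open>Here colinearity of f replaces naturality: the coaction of f n is that of n with f on
  the first leg, so g f cancels inside the sum and \<open>act_coact\<close> for N applies.\<close>

lemma integral_average_retraction:
  assumes M: "integral_entwined_module R A C \<psi> \<phi> M" and N: "integral_entwined_module R A C \<psi> \<phi> N"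
    and f: "f \<in> entwined_hom R A C N M" and g: "g \<in> right_module_hom R A M N"
    and gf: "\<And>n. n \<in> carrier N \<Longrightarrow> g (f n) = n" and n: "n \<in> carrier N"
  shows "integral_average R A C \<phi> M N g (f n) = n"
proof -
  interpret M: integral_entwined_module R A C \<psi> \<phi> M by (rule M)
  interpret N: integral_entwined_module R A C \<psi> \<phi> N by (rule N)
  note mods = M.module_M N.module_M M.module_C and X = N.coact_closed[OF n]
  have "integral_average R A C \<phi> M N g (f n) =
      tensor_lift R N (\<lambda>m c. N.act (g m) c) (tensor_map R M C f id (coact N n))"
    using f n by (simp add: integral_average_def entwined_hom_def)
  also have "\<dots> = tensor_lift R N (\<lambda>n c. N.act (g (f n)) (id c)) (coact N n)"
    by (rule tensor_lift_tensor_map[OF mods(2,3,1,3) entwined_hom_lin[OF N M f] lin_hom_id mods(2)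
          integral_average_bilin[OF M N g] X])
  also have "\<dots> = tensor_lift R N N.act (coact N n)"
    by (intro tensor_lift_cong[OF mods(2,3,2) _ _ X]) (simp_all add: gf N.act_closed)
  also have "\<dots> = n" by (rule N.act_coact[OF n])
  finally show ?thesis .
qed

theorem theorem4p2:
  fixes R :: "'k ring"
    and A :: "('k, 'a) module"
    and C :: "('k, 'c) coalgebra"
    and \<psi> :: "('k, 'c, 'a) tensor \<Rightarrow> ('k, 'a, 'c) tensor"
    and M :: "('k, 'a, 'c, 'm) entwined_module"
    and N :: "('k, 'a, 'c, 'n) entwined_module"
    and f :: "'n \<Rightarrow> 'm"
  assumes "entwining_structure R A C \<psi>"
    and "\<exists>\<phi>. normalised_integral_map R A C \<psi> \<phi>"
    and "entwined_module R A C \<psi> N"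
    and "entwined_module R A C \<psi> M"
    and "f \<in> entwined_hom R A C N M"
  shows "((\<exists>g\<in>right_module_hom R A M N. \<forall>m\<in>carrier M. f (g m) = m) \<longrightarrow>
       (\<exists>g\<in>entwined_hom R A C M N. \<forall>m\<in>carrier M. f (g m) = m))
    \<and> ((\<exists>g\<in>right_module_hom R A M N. \<forall>n\<in>carrier N. g (f n) = n) \<longrightarrow>
       (\<exists>g\<in>entwined_hom R A C M N. \<forall>n\<in>carrier N. g (f n) = n))"
proof -
  obtain \<phi> where \<phi>: "normalised_integral_map R A C \<psi> \<phi>" using assms(2) by blast
  have M: "integral_entwined_module R A C \<psi> \<phi> M" and N: "integral_entwined_module R A C \<psi> \<phi> N"
    using \<phi> assms(3,4) by (simp_all add: integral_entwined_module_def)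
  \<comment> \<open>The average of the given A-linear g is the witness in both implications.\<close>
  show ?thesis
    using integral_average_entwined_hom[OF M N] integral_average_section[OF M N assms(5)]
      integral_average_retraction[OF M N assms(5)]
    by blast
qed

end
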